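(* Let $X$ be a visual Gromov hyperbolic space whose boundary at infinity $\partial_\infty X$, taken with a visual metric, has finite capacity dimension, $\operatorname{cdim}(\partial_\infty X)<\infty$. Then there exist metric trees $T_1,\dots,T_n$, with $n=\operatorname{cdim}(\partial_\infty X)+1$, and a quasi-isometric embedding $f:X\to T_1\times\dots\times T_n$.
   Context: A map $f:X\to Y$ between metric spaces is a quasi-isometric embedding if there are $\Lambda\ge1$, $\sigma\ge0$ with $\frac1\Lambda|xx'|-\sigma\le|f(x)f(x')|\le\Lambda|xx'|+\sigma$ for all $x,x'\in X$. A metric tree is a geodesic metric space which is a real tree. Products of metric spaces carry the $\ell^2$ product metric. Gromov product: $(x|x')_o=\frac12(|xo|+|x'o|-|xx'|)$. A metric space $X$ is (Gromov) hyperbolic if for some $\delta\ge0$ and base point $o$, $(x|x'')_o\ge\min\{(x|x')_o,(x'|x'')_o\}-\delta$ for all $x,x',x''$. A sequence $(x_i)$ converges to infinity if $(x_i|x_j)_o\to\infty$ as $i,j\to\infty$; two such sequences are equivalent if $(x_i|x_i')_o\to\infty$; $\partial_\infty X$ is the set of equivalence classes. For $\xi,\xi'\in\partial_\infty X$, $(\xi|\xi')_o=\inf\liminf_i(x_i|x_i')_o$ over representatives; for $x\in X$, $(x|\xi)_o=\inf\liminf_i(x|x_i)_o$ over representatives $(x_i)\in\xi$. A metric $d$ on $\partial_\infty X$ is visual if there are $o\in X$, $a>1$, $c_1,c_2>0$ with $c_1a^{-(\xi|\xi')_o}\le d(\xi,\xi')\le c_2a^{-(\xi|\xi')_o}$ for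 all $\xi,\xi'$. $X$ is visual if for some $x_0\in X$ there is $D>0$ such that for every $x\in X$ there is $\xi\in\partial_\infty X$ with $|xx_0|\le(x|\xi)_{x_0}+D$. Capacity dimension: For a family $\mathcal U$ of subsets of a metric space $Z$, $\operatorname{mesh}(\mathcal U)=\sup_{U\in\mathcal U}\operatorname{diam}U$. A family is disjoint if its members are pairwise disjoint; a covering $\mathcal U$ of $Z$ is $(m+1)$-colored if $\mathcal U=\bigcup_{a\in A}\mathcal U^a$ with $|A|=m+1$ and each $\mathcal U^a$ disjoint. For an open covering $\mathcal U$ and $z\in Z$, $L(\mathcal U,z)=\min\{\sup_{U\in\mathcal U}\operatorname{dist}(z,Z\setminus U),\operatorname{mesh}(\mathcal U)\}$ (with $\operatorname{dist}(z,\emptyset)=\infty$) and the Lebesgue number is $L(\mathcal U)=\inf_{z\in Z}L(\mathcal U,z)$. $\operatorname{cdim}(Z)$ is the least integer $m\ge0$ for which there is $\delta>0$ such that for every sufficiently small $\tau>0$ there is an open $(m+1)$-colored covering $\mathcal U$ of $Z$ with $\operatorname{mesh}(\mathcal U)\le\tau$ and $L(\mathcal U)\ge\delta\tau$ (it is $\infty$ if no such $m$ exists). *)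

theory Defs
  imports "HOL-Analysis.Analysis"
begin

definition metric_on :: "'b set \<Rightarrow> ('b \<Rightarrow> 'b \<Rightarrow> real) \<Rightarrow> bool" where
  "metric_on S d \<longleftrightarrow>
     (\<forall>x\<in>S. \<forall>y\<in>S. 0 \<le> d x y \<and> d x y = d y x \<and> (d x y = 0 \<longleftrightarrow> x = y)) \<and>
     (\<forall>x\<in>S. \<forall>y\<in>S. \<forall>z\<in>S. d x z \<le> d x y + d y z)"

definition gromov_prod :: "'a::metric_space \<Rightarrow> 'a \<Rightarrow> 'a \<Rightarrow> real" where
  "gromov_prod o' x y = (dist x o' + dist y o' - dist x y) / 2"

definition gromov_hyperbolic :: "'a::metric_space itself \<Rightarrow> bool" where
  "gromov_hyperbolic _ \<longleftrightarrow> (\<exists>\<delta>::real. \<delta> \<ge> 0 \<and> (\<exists>o'::'a. \<forall>x y z.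
      gromov_prod o' x z \<ge> min (gromov_prod o' x y) (gromov_prod o' y z) - \<delta>))"

text \<open>Convergence to infinity, w.r.t. base point o' (independent of o').\<close>
definition conv_inf :: "'a::metric_space \<Rightarrow> (nat \<Rightarrow> 'a) \<Rightarrow> bool" where
  "conv_inf o' x \<longleftrightarrow> (\<forall>M. \<exists>N. \<forall>i\<ge>N. \<forall>j\<ge>N. gromov_prod o' (x i) (x j) \<ge> M)"

definition seq_equiv :: "'a::metric_space \<Rightarrow> (nat \<Rightarrow> 'a) \<Rightarrow> (nat \<Rightarrow> 'a) \<Rightarrow> bool" where
  "seq_equiv o' x y \<longleftrightarrow> (\<forall>M. \<exists>N. \<forall>i\<ge>N. gromov_prod o' (x i) (y i) \<ge> M)"

definition bdry :: "'a::metric_space \<Rightarrow> (nat \<Rightarrow> 'a) set set" where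
  "bdry o' = {{y. conv_inf o' y \<and> seq_equiv o' x y} | x. conv_inf o' x}"

definition gromov_prod_bdry :: "'a::metric_space \<Rightarrow> (nat \<Rightarrow> 'a) set \<Rightarrow> (nat \<Rightarrow> 'a) set \<Rightarrow> ereal" where
  "gromov_prod_bdry o' \<xi> \<eta> =
     Inf {liminf (\<lambda>i. ereal (gromov_prod o' (x i) (y i))) | x y. x \<in> \<xi> \<and> y \<in> \<eta>}"

definition gromov_prod_pt_bdry :: "'a::metric_space \<Rightarrow> 'a \<Rightarrow> (nat \<Rightarrow> 'a) set \<Rightarrow> ereal" where
  "gromov_prod_pt_bdry o' z \<xi> =
     Inf {liminf (\<lambda>i. ereal (gromov_prod o' z (x i))) | x. x \<in> \<xi>}"

definition exp_neg :: "real \<Rightarrow> ereal \<Rightarrow> real" where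
  "exp_neg a t = (if t = \<infinity> then 0 else a powr (- real_of_ereal t))"

definition visual_metric :: "'a::metric_space \<Rightarrow> ((nat \<Rightarrow> 'a) set \<Rightarrow> (nat \<Rightarrow> 'a) set \<Rightarrow> real) \<Rightarrow> bool" where
  "visual_metric b d \<longleftrightarrow> metric_on (bdry b) d \<and>
     (\<exists>o'::'a. \<exists>a>1. \<exists>c1>0. \<exists>c2>0. \<forall>\<xi>\<in>bdry b. \<forall>\<eta>\<in>bdry b.
        c1 * exp_neg a (gromov_prod_bdry o' \<xi> \<eta>) \<le> d \<xi> \<eta> \<and>
        d \<xi> \<eta> \<le> c2 * exp_neg a (gromov_prod_bdry o' \<xi> \<eta>))"

definition visual_space :: "'a::metric_space \<Rightarrow> bool" where
  "visual_space b \<longleftrightarrow> (\<exists>x0::'a. \<exists>D>0. \<forall>x. \<exists>\<xi>\<in>bdry b.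
      ereal (dist x x0) \<le> gromov_prod_pt_bdry x0 x \<xi> + ereal D)"

definition diam_on :: "('b \<Rightarrow> 'b \<Rightarrow> real) \<Rightarrow> 'b set \<Rightarrow> ereal" where
  "diam_on d U = Sup ({ereal (d x y) | x y. x \<in> U \<and> y \<in> U} \<union> {0})"

definition mesh :: "('b \<Rightarrow> 'b \<Rightarrow> real) \<Rightarrow> 'b set set \<Rightarrow> ereal" where
  "mesh d \<U> = (SUP U\<in>\<U>. diam_on d U)"

text \<open>dist(z, A) with dist(z, empty) = \<infinity>.\<close>
definition setdist_on :: "('b \<Rightarrow> 'b \<Rightarrow> real) \<Rightarrow> 'b \<Rightarrow> 'b set \<Rightarrow> ereal" where
  "setdist_on d z A = (INF w\<in>A. ereal (d z w))"

definition open_covering :: "'b set \<Rightarrow> ('b \<Rightarrow> 'b \<Rightarrow> real) \<Rightarrow> 'b set set \<Rightarrow> bool" where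
  "open_covering Z d \<U> \<longleftrightarrow> \<Union>\<U> = Z \<and>
     (\<forall>U\<in>\<U>. U \<subseteq> Z \<and> (\<forall>z\<in>U. \<exists>r>0. \<forall>w\<in>Z. d z w < r \<longrightarrow> w \<in> U))"

definition colored :: "nat \<Rightarrow> 'b set set \<Rightarrow> bool" where
  "colored k \<U> \<longleftrightarrow> (\<exists>\<V> :: nat \<Rightarrow> 'b set set.
      \<U> = (\<Union>a<k. \<V> a) \<and> (\<forall>a<k. disjoint (\<V> a)))"

definition lebesgue_at :: "'b set \<Rightarrow> ('b \<Rightarrow> 'b \<Rightarrow> real) \<Rightarrow> 'b set set \<Rightarrow> 'b \<Rightarrow> ereal" where
  "lebesgue_at Z d \<U> z = min (SUP U\<in>\<U>. setdist_on d z (Z - U)) (mesh d \<U>)"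

definition lebesgue_num :: "'b set \<Rightarrow> ('b \<Rightarrow> 'b \<Rightarrow> real) \<Rightarrow> 'b set set \<Rightarrow> ereal" where
  "lebesgue_num Z d \<U> = (INF z\<in>Z. lebesgue_at Z d \<U> z)"

definition cdim_le :: "'b set \<Rightarrow> ('b \<Rightarrow> 'b \<Rightarrow> real) \<Rightarrow> nat \<Rightarrow> bool" where
  "cdim_le Z d m \<longleftrightarrow> (\<exists>\<delta>>0. \<exists>\<tau>0>0. \<forall>\<tau>. 0 < \<tau> \<and> \<tau> \<le> \<tau>0 \<longrightarrow>
      (\<exists>\<U>. open_covering Z d \<U> \<and> colored (m + 1) \<U> \<and>
            mesh d \<U> \<le> ereal \<tau> \<and> lebesgue_num Z d \<U> \<ge> ereal (\<delta> * \<tau>)))"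

definition cdim :: "'b set \<Rightarrow> ('b \<Rightarrow> 'b \<Rightarrow> real) \<Rightarrow> enat" where
  "cdim Z d = (if \<exists>m. cdim_le Z d m then enat (LEAST m. cdim_le Z d m) else \<infinity>)"

definition geodesic_segments :: "'b set \<Rightarrow> ('b \<Rightarrow> 'b \<Rightarrow> real) \<Rightarrow> 'b \<Rightarrow> 'b \<Rightarrow> 'b set set" where
  "geodesic_segments T d x y = {\<gamma> ` {0..d x y} | \<gamma>. \<gamma> 0 = x \<and> \<gamma> (d x y) = y \<and>
      (\<forall>s\<in>{0..d x y}. \<gamma> s \<in> T) \<and>
      (\<forall>s\<in>{0..d x y}. \<forall>t\<in>{0..d x y}. d (\<gamma> s) (\<gamma> t) = \<bar>s - t\<bar>)}"

text \<open>Real tree (Bridson--Haefliger): unique geodesic segments, and concatenation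
  of segments meeting only at a common endpoint is a segment. Geodesic by (1).\<close>
definition metric_tree :: "'b set \<Rightarrow> ('b \<Rightarrow> 'b \<Rightarrow> real) \<Rightarrow> bool" where
  "metric_tree T d \<longleftrightarrow> metric_on T d \<and>
     (\<forall>x\<in>T. \<forall>y\<in>T. \<exists>!S. S \<in> geodesic_segments T d x y) \<and>
     (\<forall>x\<in>T. \<forall>y\<in>T. \<forall>z\<in>T. \<forall>S1\<in>geodesic_segments T d y x. \<forall>S2\<in>geodesic_segments T d x z.
        S1 \<inter> S2 = {x} \<longrightarrow> S1 \<union> S2 \<in> geodesic_segments T d y z)"

definition prod_dist :: "nat \<Rightarrow> (nat \<Rightarrow> 'b \<Rightarrow> 'b \<Rightarrow> real) \<Rightarrow> (nat \<Rightarrow> 'b) \<Rightarrow> (nat \<Rightarrow> 'b) \<Rightarrow> real" where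
  "prod_dist n dT p q = sqrt (\<Sum>i<n. (dT i (p i) (q i))\<^sup>2)"

definition qi_embedding :: "('a \<Rightarrow> 'a \<Rightarrow> real) \<Rightarrow> ('c \<Rightarrow> 'c \<Rightarrow> real) \<Rightarrow> ('a \<Rightarrow> 'c) \<Rightarrow> bool" where
  "qi_embedding dX dY f \<longleftrightarrow> (\<exists>\<Lambda>\<ge>1. \<exists>\<sigma>\<ge>0. \<forall>x x'.
     dX x x' / \<Lambda> - \<sigma> \<le> dY (f x) (f x') \<and> dY (f x) (f x') \<le> \<Lambda> * dX x x' + \<sigma>)"

end

theory Submission
  imports Defs
begin

text \<open>Visuality assigns to each \<open>x\<close> a boundary point \<open>\<xi> x\<close> such that, up to additive constants, the
  Gromov product of \<open>x\<close> and \<open>y\<close> at the base point \<open>p\<close> is the minimum of \<open>dist x p\<close>, \<open>dist y p\<close> and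
  \<open>- log a (d (\<xi> x) (\<xi> y))\<close>. The capacity dimension provides coloured coverings of the boundary at
  all scales \<open>\<tau> k\<close>, decreasing geometrically. Within each colour they are made laminar with a
  margin: a set of level \<open>k\<close> that meets a set of a finer level \<open>l\<close> contains a neighbourhood of it of
  radius proportional to \<open>\<tau> l\<close>. The sets of one colour containing \<open>\<xi> x\<close>, of levels up to
  \<open>dist x p\<close> in suitable units, are then the vertices on a branch of a rooted tree ending at the
  image of \<open>x\<close>. The distance of the images of \<open>x\<close> and \<open>y\<close> in that tree is the size of a symmetric
  difference. By the margin, at most one set is lost before the branching level, which gives the
  upper bound; by the covering property each level beyond it is seen by some colour, which gives
  the lower bound.\<close>

section \<open>Trees from ultrametric Gromov products\<close>

text \<open>Apply \<open>four\<close> to the pairs \<open>x, y\<close> and \<open>r, r'\<close>: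
  both sums on the right equal \<open>d x y\<close>, so nothing is left for
  \<open>d r r'\<close>.\<close>

lemma unique_point_on_interval:
  assumes met: "metric_on T d"
    and four: "\<And>p q r s. \<lbrakk>p \<in> T; q \<in> T; r \<in> T; s \<in> T\<rbrakk> \<Longrightarrow>
        d p q + d r s \<le> max (d p r + d q s) (d p s + d q r)"
    and "x \<in> T" "y \<in> T" "r \<in> T" "r' \<in> T"
    and "d x r + d r y = d x y" "d x r' + d r' y = d x y" "d x r = d x r'"
  shows "r = r'"
proof -
  have "d x y + d r r' \<le> max (d x r + d y r') (d x r' + d y r)"
    using assms by blast
  moreover have "d y r = d r y" "d y r' = d r' y" "0 \<le> d r r'"
    using assms unfolding metric_on_def by blast+
  ultimately have "d r r' = 0"
    using assms(7-9) by linarith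
  then show ?thesis
    using assms unfolding metric_on_def by blast
qed

text \<open>A point of the metric interval is fixed by its distance from \<open>x\<close>, so it
  coincides with the point of any geodesic at that parameter. Segments become unique and free of
  parametrisations.\<close>

lemma geodesic_segments_eq_interval:
  assumes met: "metric_on T d"
    and four: "\<And>p q r s. \<lbrakk>p \<in> T; q \<in> T; r \<in> T; s \<in> T\<rbrakk> \<Longrightarrow>
        d p q + d r s \<le> max (d p r + d q s) (d p s + d q r)"
    and xy: "x \<in> T" "y \<in> T"
    and geo: "geodesic_segments T d x y \<noteq> {}"
  shows "geodesic_segments T d x y = {{r \<in> T. d x r + d r y = d x y}}"
proof -
  have "S = {r \<in> T. d x r + d r y = d x y}" if S: "S \<in> geodesic_segments T d x y" for S
  proof -
    obtain \<gamma> where \<gamma>: "S = \<gamma> ` {0..d x y}" "\<gamma> 0 = x" "\<gamma> (d x y) = y"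
      "\<And>s. s \<in> {0..d x y} \<Longrightarrow> \<gamma> s \<in> T"
      "\<And>s t. s \<in> {0..d x y} \<Longrightarrow> t \<in> {0..d x y} \<Longrightarrow> d (\<gamma> s) (\<gamma> t) = \<bar>s - t\<bar>"
      using S unfolding geodesic_segments_def by blast
    have pos: "0 \<le> d x y"
      using met xy unfolding metric_on_def by blast
    have dx: "d x (\<gamma> s) = s" "d (\<gamma> s) y = d x y - s" if "s \<in> {0..d x y}" for s
      using \<gamma>(5)[of 0 s] \<gamma>(5)[of s "d x y"] that \<gamma>(2,3) pos by auto
    show ?thesis
    proof (intro equalityI subsetI)
      fix r assume "r \<in> S"
      then show "r \<in> {r \<in> T. d x r + d r y = d x y}"
        using \<gamma>(1,4) dx by auto
    next
      fix r assume "r \<in> {r \<in> T. d x r + d r y = d x y}"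
      then have r: "r \<in> T" "d x r + d r y = d x y" by auto
      have "0 \<le> d x r" "0 \<le> d r y"
        using met xy r(1) unfolding metric_on_def by blast+
      then have s: "d x r \<in> {0..d x y}"
        using r(2) by auto
      have "r = \<gamma> (d x r)"
        by (rule unique_point_on_interval[OF met four xy]) (use r s \<gamma>(4) dx in auto)
      then show "r \<in> S"
        using s \<gamma>(1) by blast
    qed
  qed
  then show ?thesis
    using geo by blast
qed

text \<open>Segments are metric intervals, and if two of them meet only at \<open>x\<close>, then
  the four-point inequality makes the Gromov product of their other ends at \<open>x\<close> vanish,
  so their lengths add up.\<close>

lemma metric_treeI_four_point:
  assumes met: "metric_on T d"
    and four: "\<And>p q r s. \<lbrakk>p \<in> T; q \<in> T; r \<in> T; s \<in> T\<rbrakk> \<Longrightarrow>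
        d p q + d r s \<le> max (d p r + d q s) (d p s + d q r)"
    and geo: "\<And>x y. x \<in> T \<Longrightarrow> y \<in> T \<Longrightarrow> geodesic_segments T d x y \<noteq> {}"
  shows "metric_tree T d"
proof -
  define I where "I x y = {r \<in> T. d x r + d r y = d x y}" for x y
  have seg: "geodesic_segments T d x y = {I x y}" if "x \<in> T" "y \<in> T" for x y
    unfolding I_def using geodesic_segments_eq_interval[OF met four that geo[OF that]] .
  have sym: "d x y = d y x" and nonneg: "0 \<le> d x y" and zero: "d x y = 0 \<longleftrightarrow> x = y"
    if "x \<in> T" "y \<in> T" for x y
    using met that unfolding metric_on_def by blast+
  have tri: "d x z \<le> d x y + d y z" if "x \<in> T" "y \<in> T" "z \<in> T" for x y z
    using met that unfolding metric_on_def by blast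
  have pt: "\<exists>r\<in>I x y. d x r = s" if xy: "x \<in> T" "y \<in> T" and s: "0 \<le> s" "s \<le> d x y" for x y s
  proof -
    have "I x y \<in> geodesic_segments T d x y"
      using seg[OF xy] by simp
    then obtain \<gamma> where \<gamma>: "I x y = \<gamma> ` {0..d x y}" "\<gamma> 0 = x"
      "\<And>s t. s \<in> {0..d x y} \<Longrightarrow> t \<in> {0..d x y} \<Longrightarrow> d (\<gamma> s) (\<gamma> t) = \<bar>s - t\<bar>"
      unfolding geodesic_segments_def by blast
    show ?thesis
      using \<gamma>(1,2) \<gamma>(3)[of 0 s] s by (intro bexI[of _ "\<gamma> s"]) auto
  qed
  have Isym: "I x y = I y x" if "x \<in> T" "y \<in> T" for x y
  proof -
    have "d x r + d r y = d x y \<longleftrightarrow> d y r + d r x = d y x" if "r \<in> T" for r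
      using sym[of x r] sym[of y r] sym[of x y] \<open>x \<in> T\<close> \<open>y \<in> T\<close> that by auto
    then show ?thesis unfolding I_def by auto
  qed
  have concat: "I y x \<union> I x z = I y z"
    if T: "x \<in> T" "y \<in> T" "z \<in> T" and meet: "I y x \<inter> I x z = {x}" for x y z
  proof -
    \<comment> \<open>The Gromov product of \<open>y\<close> and \<open>z\<close> at
      \<open>x\<close>. The point \<open>w\<close> at this distance from \<open>x\<close> towards
      \<open>y\<close> turns out to lie on the segment to \<open>z\<close> too, which forces
      \<open>w = x\<close> and \<open>\<mu> = 0\<close>.\<close>
    define \<mu> where "\<mu> = (d x y + d x z - d y z) / 2"
    have \<mu>: "0 \<le> \<mu>" "\<mu> \<le> d x y" "\<mu> \<le> d x z"
      using tri[of y x z] tri[of x z y] tri[of x y z] sym[of x y] sym[of z y] T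
      unfolding \<mu>_def by auto
    obtain w where w: "w \<in> I x y" "d x w = \<mu>" using pt \<mu> T by blast
    obtain w' where w': "w' \<in> I x z" "d x w' = \<mu>" using pt \<mu> T by blast
    have wT: "w \<in> T" "w' \<in> T" "d x w + d w y = d x y" "d x w' + d w' z = d x z"
      using w w' unfolding I_def by auto
    have wz: "d w z = d x z - \<mu>"
    proof (rule antisym)
      \<comment> \<open>By the choice of \<open>\<mu>\<close>, both sums on the right equal
        \<open>d x y + d x z - \<mu>\<close>.\<close>
      have "d w z + d x y \<le> max (d w x + d z y) (d w y + d z x)"
        using four T wT by blast
      then show "d w z \<le> d x z - \<mu>"
        using wT w(2) sym[OF wT(1) T(1)] sym[OF T(3,2)] sym[OF T(3,1)] \<mu>_def by (simp add: field_simps)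
      show "d x z - \<mu> \<le> d w z"
        using tri[OF T(1) wT(1) T(3)] w(2) by linarith
    qed
    have "w \<in> I x z"
      using wz w(2) wT unfolding I_def by auto
    then have "w = x"
      using w(1) meet Isym[of x y] T by blast
    then have "\<mu> = 0"
      using w(2) zero T by blast
    then have add: "d y z = d y x + d x z"
      unfolding \<mu>_def using sym[OF T(1,2)] by auto
    have sub: "I y x \<subseteq> I y z" "I x z \<subseteq> I y z"
    proof -
      show "I y x \<subseteq> I y z"
      proof
        fix r assume "r \<in> I y x"
        then have r: "r \<in> T" "d y r + d r x = d y x" unfolding I_def by auto
        have "d y r + d r z = d y z"
          using tri[OF T(2) r(1) T(3)] tri[OF r(1) T(1,3)] r(2) add by linarith
        then show "r \<in> I y z" using r unfolding I_def by auto
      qed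
      show "I x z \<subseteq> I y z"
      proof
        fix r assume "r \<in> I x z"
        then have r: "r \<in> T" "d x r + d r z = d x z" unfolding I_def by auto
        have "d y r + d r z = d y z"
          using tri[OF T(2) r(1) T(3)] tri[OF T(2,1) r(1)] r(2) add by linarith
        then show "r \<in> I y z" using r unfolding I_def by auto
      qed
    qed
    moreover have "r \<in> I y x \<union> I x z" if "r \<in> I y z" for r
    proof -
      have r: "r \<in> T" "d y r + d r z = d y z" using that unfolding I_def by auto
      show ?thesis
      proof (cases "d y r \<le> d y x")
        case True
        obtain u where u: "u \<in> I y x" "d y u = d y r"
          using pt[of y x "d y r"] True nonneg r T by blast
        have "u \<in> T" "d y u + d u z = d y z"
          using u(1) sub(1) unfolding I_def by auto
        then have "r = u"
          using unique_point_on_interval[OF met four T(2,3) r(1) _ r(2)] u(2) by simp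
        then show ?thesis using u by blast
      next
        case False
        then have le: "0 \<le> d y r - d y x" "d y r - d y x \<le> d x z"
          using nonneg[of r z] r T add by auto
        obtain u where u: "u \<in> I x z" "d x u = d y r - d y x"
          using pt[OF T(1,3) le] by blast
        have uT: "u \<in> T" "d y u + d u z = d y z" "d x u + d u z = d x z"
          using u(1) sub(2) unfolding I_def by auto
        then have "r = u"
          using unique_point_on_interval[OF met four T(2,3) r(1) _ r(2)] u(2) add by simp
        then show ?thesis using u by blast
      qed
    qed
    ultimately show ?thesis by blast
  qed
  show ?thesis
    unfolding metric_tree_def
  proof (intro conjI ballI impI)
    show "metric_on T d" by (rule met)
  next
    fix x y assume "x \<in> T" "y \<in> T"
    then show "\<exists>!S. S \<in> geodesic_segments T d x y"
      using seg by simp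
  next
    fix x y z S1 S2
    assume "x \<in> T" "y \<in> T" "z \<in> T" "S1 \<in> geodesic_segments T d y x"
      "S2 \<in> geodesic_segments T d x z" "S1 \<inter> S2 = {x}"
    then show "S1 \<union> S2 \<in> geodesic_segments T d y z"
      using seg concat by simp
  qed
qed

text \<open>Four ultrametric triangles each bound one cross product by \<open>M p q\<close> or
  \<open>M r s\<close>, and no combination of these bounds allows both strict inequalities. For
  distances of the form height plus height minus \<open>2 * M\<close> the heights cancel, and this
  is the four-point inequality.\<close>

lemma four_point_of_ultrametric_product:
  fixes M :: "'b \<Rightarrow> 'b \<Rightarrow> real"
  assumes ultra: "\<And>p q r. \<lbrakk>p \<in> P; q \<in> P; r \<in> P\<rbrakk> \<Longrightarrow> min (M p q) (M q r) \<le> M p r"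
    and sym: "\<And>p q. M p q = M q p"
    and P: "p \<in> P" "q \<in> P" "r \<in> P" "s \<in> P"
  shows "min (M p r + M q s) (M p s + M q r) \<le> M p q + M r s"
proof (rule ccontr)
  assume "\<not> ?thesis"
  then have neg: "M p q + M r s < M p r + M q s" "M p q + M r s < M p s + M q r"
    by auto
  have "M p r \<le> M p q \<or> M q r \<le> M p q" "M p s \<le> M p q \<or> M q s \<le> M p q"
    "M p r \<le> M r s \<or> M p s \<le> M r s" "M q r \<le> M r s \<or> M q s \<le> M r s"
    using ultra[OF P(1,3,2)] ultra[OF P(1,4,2)] ultra[OF P(3,1,4)] ultra[OF P(3,2,4)]
    unfolding sym[of r q] sym[of s q] sym[of r p] by (simp_all add: min_le_iff_disj)
  then show False
    using neg by (elim disjE) linarith+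
qed

text \<open>The tree is the set of pairs \<open>(x, t)\<close> with \<open>0 \<le> t \<le> g x x\<close>, thought of as the point at height
  \<open>t\<close> on the branch from the root to \<open>x\<close>; the branches of \<open>x\<close> and \<open>y\<close> are glued up to height \<open>g x y\<close>.
  Choosing one pair in each glueing class keeps the tree inside \<open>'a \<times> real\<close>.\<close>
lemma tree_of_ultrametric_product:
  fixes g :: "'a \<Rightarrow> 'a \<Rightarrow> real"
  assumes sym: "\<And>x y. g x y = g y x" and nonneg: "\<And>x y. 0 \<le> g x y"
    and le: "\<And>x y. g x y \<le> g x x"
    and ultra: "\<And>x y z. min (g x y) (g y z) \<le> g x z"
  shows "\<exists>(T :: ('a \<times> real) set) dT f. metric_tree T dT \<and>
           (\<forall>x. f x \<in> T) \<and> (\<forall>x y. dT (f x) (f y) = g x x + g y y - 2 * g x y)"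
proof -
  define P where "P = {(x, t). 0 \<le> t \<and> t \<le> g x x}"
  define M where "M = (\<lambda>(x, t) (y, s). min (min t s) (g x y))"
  define d where "d p q = snd p + snd q - 2 * M p q" for p q :: "'a \<times> real"
  have Msym: "M p q = M q p" for p q
    unfolding M_def using sym by (auto simp: split_beta min.commute)
  have Mult: "min (M p q) (M q r) \<le> M p r" for p q r
    unfolding M_def using ultra[of "fst p" "fst q" "fst r"] by (auto simp: split_beta)
  have Mle: "M p q \<le> snd p" "M p q \<le> snd q" for p q
    unfolding M_def by (auto simp: split_beta)
  have Mself: "M p p = snd p" if "p \<in> P" for p
    using that unfolding M_def P_def by auto
  have dnonneg: "0 \<le> d p q" for p q
    using Mle[of p q] unfolding d_def by auto
  have dsym: "d p q = d q p" for p q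
    using Msym[of p q] unfolding d_def by auto
  \<comment> \<open>Equivalent to \<open>M p q + M q r \<le> snd q + M p r\<close>: the smaller term
    on the left is at most \<open>M p r\<close>, the larger at most \<open>snd q\<close>.\<close>
  have dtri: "d p r \<le> d p q + d q r" for p q r
    using Mult[of p q r] Mle(2)[of p q] Mle(1)[of q r] unfolding d_def by linarith
  have dself: "d p p = 0" if "p \<in> P" for p
    using Mself[OF that] unfolding d_def by auto
  define rep where "rep p = (SOME q. q \<in> P \<and> d p q = 0)" for p
  have rep: "rep p \<in> P" "d p (rep p) = 0" if "p \<in> P" for p
    using someI[of "\<lambda>q. q \<in> P \<and> d p q = 0" p] dself[OF that] that unfolding rep_def by auto
  have drep: "d (rep p) (rep q) = d p q" if "p \<in> P" "q \<in> P" for p q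
    using dtri[of "rep p" "rep q" p] dtri[of p "rep q" q] dtri[of p q "rep p"]
      dtri[of "rep p" q "rep q"] rep(2)[OF that(1)] rep(2)[OF that(2)] dsym[of p "rep p"] dsym[of q "rep q"]
      dtri[of p q "rep q"] dtri[of p "rep p" q] dsym[of q "rep p"]
    by linarith
  have rep_eq: "rep p = rep q" if "p \<in> P" "q \<in> P" "d p q = 0" for p q
  proof -
    have "d p r = 0 \<longleftrightarrow> d q r = 0" for r
      using dtri[of p r q] dtri[of q r p] dsym[of p q] dnonneg[of p r] dnonneg[of q r] that(3)
      by linarith
    then show ?thesis unfolding rep_def by simp
  qed
  have met: "metric_on (rep ` P) d"
    unfolding metric_on_def
  proof (intro conjI ballI)
    fix p' q' assume pq': "p' \<in> rep ` P" "q' \<in> rep ` P"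
    show "0 \<le> d p' q'" "d p' q' = d q' p'" by (rule dnonneg, rule dsym)
    obtain p q where pq: "p \<in> P" "q \<in> P" "p' = rep p" "q' = rep q"
      using pq' by blast
    show "d p' q' = 0 \<longleftrightarrow> p' = q'"
      using pq drep rep_eq dself[OF rep(1)] by metis
  next
    fix p q r show "d p r \<le> d p q + d q r" by (rule dtri)
  qed
  have four: "d p q + d r s \<le> max (d p r + d q s) (d p s + d q r)" for p q r s
    using four_point_of_ultrametric_product[of UNIV M p q r s] Mult Msym
    unfolding d_def by auto
  have geo: "geodesic_segments (rep ` P) d p' q' \<noteq> {}" if pq': "p' \<in> rep ` P" "q' \<in> rep ` P" for p' q'
  proof -
    obtain p q where pq: "p \<in> P" "q \<in> P" "p' = rep p" "q' = rep q"
      using pq' by blast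
    obtain x t y s where xy: "p = (x, t)" "q = (y, s)" by (metis surj_pair)
    define m where "m = M p q"
    have ts: "0 \<le> t" "t \<le> g x x" "0 \<le> s" "s \<le> g y y" "m \<le> t" "m \<le> s" "m \<le> g x y" "0 \<le> m"
      "m = t \<or> m = s \<or> m = g x y"
      using pq xy Mle[of p q] nonneg[of x y] unfolding P_def m_def M_def by auto
    have L: "d p q = t + s - 2 * m" unfolding d_def m_def xy by simp
    \<comment> \<open>Descend the branch of \<open>x\<close> from height \<open>t\<close> to the
      meeting height \<open>m\<close>, then climb the branch of \<open>y\<close>. The path runs in
      \<open>P\<close>; composing with \<open>rep\<close> moves it into the tree.\<close>
    define \<gamma> where "\<gamma> u = (if u \<le> t - m then (x, t - u) else (y, u - t + 2 * m))" for u
    have \<gamma>P: "\<gamma> u \<in> P" if "u \<in> {0..d p q}" for u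
      using that ts(2,4,8) L unfolding \<gamma>_def P_def by (cases "u \<le> t - m") auto
    have same: "d (w, u) (w, v) = \<bar>u - v\<bar>" if "u \<le> g w w" "v \<le> g w w" for w u v
      using that unfolding d_def M_def by (simp add: min_def)
    have cross: "d (x, u) (y, v) = u + v - 2 * m" if "m \<le> u" "u \<le> t" "m \<le> v" "v \<le> s" for u v
    proof -
      have "min (min u v) (g x y) = m"
        using that ts(7,9) by linarith
      then show ?thesis unfolding d_def M_def by simp
    qed
    have aux: "d (\<gamma> u) (\<gamma> v) = v - u" if uv: "u \<in> {0..d p q}" "v \<in> {0..d p q}" "u \<le> v" for u v
    proof -
      consider "v \<le> t - m" | "u \<le> t - m" "t - m < v" | "t - m < u"
        by linarith
      then show ?thesis
      proof cases
        case 1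
        then have "\<gamma> u = (x, t - u)" "\<gamma> v = (x, t - v)"
          using uv(3) unfolding \<gamma>_def by auto
        then show ?thesis
          using same[of "t - u" x "t - v"] uv ts(2) by simp
      next
        case 2
        then have "\<gamma> u = (x, t - u)" "\<gamma> v = (y, v - t + 2 * m)"
          unfolding \<gamma>_def by auto
        then show ?thesis
          using cross[of "t - u" "v - t + 2 * m"] uv 2 L by simp
      next
        case 3
        then have "\<gamma> u = (y, u - t + 2 * m)" "\<gamma> v = (y, v - t + 2 * m)"
          using uv(3) unfolding \<gamma>_def by auto
        then show ?thesis
          using same[of "u - t + 2 * m" y "v - t + 2 * m"] uv ts(4) L by simp
      qed
    qed
    have iso: "d (\<gamma> u) (\<gamma> v) = \<bar>u - v\<bar>" if "u \<in> {0..d p q}" "v \<in> {0..d p q}" for u v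
      using aux[OF that] aux[OF that(2,1)] dsym[of "\<gamma> u" "\<gamma> v"] by linarith
    have end0: "rep (\<gamma> 0) = p'"
      using ts(5) unfolding pq(3) xy \<gamma>_def by simp
    \<comment> \<open>If \<open>s = m\<close> the path never leaves the branch of \<open>x\<close>
      and ends at \<open>(x, m)\<close>, which is only glued to \<open>q\<close>; hence distance
      zero instead of equality.\<close>
    have "d (\<gamma> (d p q)) q = 0"
    proof (cases "s \<le> m")
      case True
      then have "\<gamma> (d p q) = (x, m)" "s = m"
        using ts(5,6) L unfolding \<gamma>_def by auto
      then show ?thesis
        using cross[of m s] ts(5) xy by simp
    next
      case False
      then have "\<gamma> (d p q) = (y, s)"
        using ts(5,6) L unfolding \<gamma>_def by auto
      then show ?thesis
        using dself[OF pq(2)] xy by simp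
    qed
    then have end1: "rep (\<gamma> (d p q)) = q'"
      unfolding pq(4) using \<gamma>P[of "d p q"] dnonneg[of p q] pq(2) by (intro rep_eq) auto
    have dd: "d p' q' = d p q"
      unfolding pq(3,4) by (rule drep[OF pq(1,2)])
    have "(rep \<circ> \<gamma>) ` {0..d p' q'} \<in> geodesic_segments (rep ` P) d p' q'"
      unfolding geodesic_segments_def
      using end0 end1 \<gamma>P iso drep unfolding dd by (intro CollectI exI[of _ "rep \<circ> \<gamma>"]) auto
    then show ?thesis by blast
  qed
  have "metric_tree (rep ` P) d"
    using met four geo by (rule metric_treeI_four_point)
  moreover have inP: "(x, g x x) \<in> P" for x
    using nonneg unfolding P_def by auto
  moreover have "d (rep (x, g x x)) (rep (y, g y y)) = g x x + g y y - 2 * g x y" for x y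
    using le[of x y] le[of y x] sym[of x y] unfolding drep[OF inP inP] by (auto simp: d_def M_def)
  ultimately show ?thesis
    by (intro exI[of _ "rep ` P"] exI[of _ d] exI[of _ "\<lambda>x. rep (x, g x x)"]) auto
qed

text \<open>The cardinality of \<open>S x \<inter> S y\<close> serves as the product. By
  \<open>nested\<close>, one of two consecutive intersections is contained in the outer one, which
  is the ultrametric inequality.\<close>

lemma tree_of_nested_sets:
  fixes S :: "'a \<Rightarrow> 'c set"
  assumes fin: "\<And>x. finite (S x)"
    and nested: "\<And>x y z. S x \<inter> S y \<subseteq> S z \<or> S y \<inter> S z \<subseteq> S x"
  shows "\<exists>(T :: ('a \<times> real) set) dT f. metric_tree T dT \<and> (\<forall>x. f x \<in> T) \<and>
           (\<forall>x y. dT (f x) (f y) = real (card (S x - S y)) + real (card (S y - S x)))"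
proof -
  define g where "g x y = real (card (S x \<inter> S y))" for x y
  have "\<exists>(T :: ('a \<times> real) set) dT f. metric_tree T dT \<and>
           (\<forall>x. f x \<in> T) \<and> (\<forall>x y. dT (f x) (f y) = g x x + g y y - 2 * g x y)"
  proof (rule tree_of_ultrametric_product)
    show "g x y = g y x" for x y unfolding g_def by (simp add: Int_commute)
    show "0 \<le> g x y" for x y unfolding g_def by simp
    show "g x y \<le> g x x" for x y unfolding g_def using fin by (auto intro: card_mono)
    show "min (g x y) (g y z) \<le> g x z" for x y z
    proof -
      have "S x \<inter> S y \<subseteq> S x \<inter> S z \<or> S y \<inter> S z \<subseteq> S x \<inter> S z"
        using nested[of x y z] by blast
      then have "g x y \<le> g x z \<or> g y z \<le> g x z"
        unfolding g_def using fin card_mono[of "S x \<inter> S z"] by auto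
      then show ?thesis by auto
    qed
  qed
  moreover have "g x x + g y y - 2 * g x y = real (card (S x - S y)) + real (card (S y - S x))" for x y
  proof -
    have "card (S x) = card (S x \<inter> S y) + card (S x - S y)"
         "card (S y) = card (S x \<inter> S y) + card (S y - S x)"
      using fin card_Int_Diff[of "S x" "S y"] card_Int_Diff[of "S y" "S x"] by (auto simp: Int_commute)
    then show ?thesis unfolding g_def by auto
  qed
  ultimately show ?thesis by simp
qed

section \<open>Laminar families from coloured coverings\<close>

text \<open>\<open>N k\<close> is one colour class of a covering at scale \<open>\<tau> k\<close>. Fattening its members slightly and
  saturating with respect to chains of fattened members of all finer levels makes the members of
  different levels either disjoint or nested with a margin, while moving points only by a small
  fraction of \<open>\<tau> k\<close>.\<close>
locale separated_families =
  fixes \<rho> :: "'a \<Rightarrow> 'a \<Rightarrow> real" and N :: "nat \<Rightarrow> 'a set set" and \<tau> :: "nat \<Rightarrow> real" and \<eta> :: real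
  assumes refl [simp]: "\<rho> x x = 0"
    and sym: "\<rho> x y = \<rho> y x"
    and tri: "\<rho> x z \<le> \<rho> x y + \<rho> y z"
    and \<eta>: "0 < \<eta>" "\<eta> \<le> 1"
    and \<tau>_pos: "0 < \<tau> k"
    and \<tau>_Suc: "\<tau> (Suc k) \<le> \<eta> / 16 * \<tau> k"
    and diam: "V \<in> N k \<Longrightarrow> v \<in> V \<Longrightarrow> w \<in> V \<Longrightarrow> \<rho> v w \<le> \<tau> k"
    and sep: "V \<in> N k \<Longrightarrow> W \<in> N k \<Longrightarrow> V \<noteq> W \<Longrightarrow> v \<in> V \<Longrightarrow> w \<in> W \<Longrightarrow> \<eta> * \<tau> k \<le> \<rho> v w"
begin

text \<open>With a quarter of the separation as radius, distinct fattened members of one level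
  remain \<open>\<eta> * \<tau> k / 2\<close> apart.\<close>

definition fat :: "nat \<Rightarrow> 'a set \<Rightarrow> 'a set" where
  "fat k V = {x. \<exists>v\<in>V. \<rho> v x \<le> \<eta> * \<tau> k / 4}"

definition block :: "nat \<Rightarrow> 'a \<Rightarrow> 'a \<Rightarrow> bool" where
  "block k x y \<longleftrightarrow> (\<exists>V\<in>N k. x \<in> fat k V \<and> y \<in> fat k V)"

text \<open>The upper bound \<open>K\<close> on the levels permits downward induction on
  \<open>k\<close>; \<open>linked\<close> is the version without it.\<close>

inductive chain :: "nat \<Rightarrow> nat \<Rightarrow> 'a \<Rightarrow> 'a \<Rightarrow> bool" for k K where
  start: "chain k K x x"
| step: "chain k K x y \<Longrightarrow> k \<le> l \<Longrightarrow> l < K \<Longrightarrow> block l y z \<Longrightarrow> chain k K x z"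

definition linked :: "nat \<Rightarrow> 'a \<Rightarrow> 'a \<Rightarrow> bool" where
  "linked k = (\<lambda>x y. \<exists>l\<ge>k. block l x y)\<^sup>*\<^sup>*"

text \<open>Only strictly finer levels enlarge \<open>V\<close>, so points move by at most
  \<open>2 * \<tau> (Suc k)\<close>, a small fraction of the separation at level
  \<open>k\<close>.\<close>

definition envelope :: "nat \<Rightarrow> 'a set \<Rightarrow> 'a set" where
  "envelope k V = {z. \<exists>v\<in>V. linked (Suc k) v z}"

lemma fat_superset: "V \<subseteq> fat k V"
  unfolding fat_def using \<eta> \<tau>_pos[of k] by force

lemma fat_diam:
  assumes "V \<in> N k" "x \<in> fat k V" "y \<in> fat k V"
  shows "\<rho> x y \<le> \<tau> k + \<eta> * \<tau> k / 2"
proof -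
  obtain v w where "v \<in> V" "w \<in> V" "\<rho> v x \<le> \<eta> * \<tau> k / 4" "\<rho> w y \<le> \<eta> * \<tau> k / 4"
    using assms unfolding fat_def by blast
  moreover have "\<rho> v w \<le> \<tau> k"
    using diam assms(1) calculation(1,2) .
  ultimately show ?thesis
    using tri[of x y v] tri[of v y w] sym[of x v] by linarith
qed

lemma fat_unique:
  assumes "V \<in> N k" "W \<in> N k" "x \<in> fat k V" "y \<in> fat k W" "\<rho> x y < \<eta> * \<tau> k / 2"
  shows "V = W"
proof (rule ccontr)
  assume "V \<noteq> W"
  obtain v w where "v \<in> V" "w \<in> W" "\<rho> v x \<le> \<eta> * \<tau> k / 4" "\<rho> w y \<le> \<eta> * \<tau> k / 4"
    using assms unfolding fat_def by blast
  moreover have "\<eta> * \<tau> k \<le> \<rho> v w"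
    using sep[OF assms(1,2) \<open>V \<noteq> W\<close>] calculation by blast
  ultimately show False
    using tri[of v w x] tri[of x w y] sym[of w y] assms(5) by linarith
qed

text \<open>The piece between the first and the last visit to level \<open>k\<close> is cut out.
  Finer pieces between two visits are too short to change the member, so one \<open>V\<close> serves
  for both.\<close>

lemma chain_Suc_cases:
  assumes small: "\<And>x y. chain (Suc k) K x y \<Longrightarrow> \<rho> x y < \<eta> * \<tau> k / 2"
    and "chain k K x y"
  shows "chain (Suc k) K x y \<or>
    (\<exists>V\<in>N k. \<exists>p\<in>fat k V. \<exists>q\<in>fat k V. chain (Suc k) K x p \<and> chain (Suc k) K q y)"
  using assms(2)
proof (induction rule: chain.induct)
  case (start x)
  show ?case by (simp add: chain.start)
next
  case (step x y l z)
  show ?case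
  proof (cases "l = k")
    case False
    then have "Suc k \<le> l" using step.hyps by simp
    then show ?thesis
      using step.IH step.hyps chain.step by meson
  next
    case True
    then obtain W where W: "W \<in> N k" "y \<in> fat k W" "z \<in> fat k W"
      using step.hyps unfolding block_def by blast
    from step.IH show ?thesis
    proof
      assume "chain (Suc k) K x y"
      then show ?thesis
        using W chain.start by blast
    next
      assume "\<exists>V\<in>N k. \<exists>p\<in>fat k V. \<exists>q\<in>fat k V. chain (Suc k) K x p \<and> chain (Suc k) K q y"
      then obtain V p q where V: "V \<in> N k" "p \<in> fat k V" "q \<in> fat k V"
        "chain (Suc k) K x p" "chain (Suc k) K q y"
        by blast
      have "V = W"
        using fat_unique[OF V(1) W(1) V(3) W(2) small[OF V(5)]] .
      then show ?thesis
        using V W chain.start by blast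
    qed
  qed
qed

text \<open>Two members of level \<open>k\<close> lie too far apart to be joined by a chain of finer levels, so a chain
  visits at most one of them.\<close>
lemma chain_bound:
  assumes "k \<le> K" "chain k K x y"
  shows "\<rho> x y \<le> 2 * \<tau> k"
  using assms
\<comment> \<open>The induction descends from \<open>k = K\<close>, where a chain cannot move, so
  the induction hypothesis concerns the finer levels.\<close>
proof (induction k arbitrary: x y rule: inc_induct)
  case base
  then have "x = y"
    by (auto elim: chain.cases)
  then show ?case using \<tau>_pos[of K] by simp
next
  case (step k)
  have \<tau>S: "2 * \<tau> (Suc k) \<le> \<eta> * \<tau> k / 8" "\<eta> * \<tau> k \<le> \<tau> k" "0 < \<eta> * \<tau> k"
    using \<tau>_Suc[of k] \<eta> \<tau>_pos[of k] by auto
  have small: "\<rho> x y < \<eta> * \<tau> k / 2" if "chain (Suc k) K x y" for x y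
    using step.IH[OF that] \<tau>S by linarith
  from chain_Suc_cases[OF small step.prems] show ?case
  proof
    assume "chain (Suc k) K x y"
    then show ?thesis
      using small[of x y] \<tau>S \<tau>_pos[of k] by linarith
  next
    assume "\<exists>V\<in>N k. \<exists>p\<in>fat k V. \<exists>q\<in>fat k V. chain (Suc k) K x p \<and> chain (Suc k) K q y"
    then obtain V p q where V: "V \<in> N k" "p \<in> fat k V" "q \<in> fat k V"
      "chain (Suc k) K x p" "chain (Suc k) K q y" by blast
    \<comment> \<open>Each outer piece costs at most \<open>\<eta> * \<tau> k / 8\<close> and the
      passage through \<open>fat k V\<close> at most
      \<open>\<tau> k + \<eta> * \<tau> k / 2\<close>; since \<open>\<eta> \<le> 1\<close>, the
      total stays below \<open>2 * \<tau> k\<close>.\<close>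
    show ?thesis
      using step.IH[OF V(4)] step.IH[OF V(5)] fat_diam[OF V(1-3)] tri[of x y p] tri[of p y q] \<tau>S
      by linarith
  qed
qed

lemma chain_mono: "chain k K x y \<Longrightarrow> K \<le> L \<Longrightarrow> chain k L x y"
  by (induction rule: chain.induct) (auto intro: chain.intros)

lemma linked_imp_chain:
  assumes "linked k x y"
  shows "\<exists>K\<ge>k. chain k K x y"
  using assms unfolding linked_def
proof (induction rule: rtranclp_induct)
  case base
  then show ?case by (auto intro: chain.start)
next
  case (step y z)
  then obtain K l where K: "K \<ge> k" "chain k K x y" and l: "k \<le> l" "block l y z" by blast
  have "chain k (max K (Suc l)) x z"
    using chain_mono[OF K(2)] l by (intro chain.step[of k _ x y l z]) auto
  then show ?case using K(1) by (intro exI[of _ "max K (Suc l)"]) auto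
qed

text \<open>A link uses finitely many levels, and the bound for chains does not depend on
  \<open>K\<close>.\<close>

lemma linked_bound: "linked k x y \<Longrightarrow> \<rho> x y \<le> 2 * \<tau> k"
  using linked_imp_chain chain_bound by blast

lemma linked_trans: "linked k x y \<Longrightarrow> linked k y z \<Longrightarrow> linked k x z"
  unfolding linked_def by (rule rtranclp_trans)

lemma linked_sym: "linked k x y \<Longrightarrow> linked k y x"
proof -
  have "symp (\<lambda>x y. \<exists>l\<ge>k. block l x y)"
    unfolding block_def symp_def by blast
  then show "linked k x y \<Longrightarrow> linked k y x"
    unfolding linked_def by (metis symp_rtranclp sympD)
qed

lemma linked_antimono:
  assumes "k \<le> l" "linked l x y"
  shows "linked k x y"
  using assms(2) unfolding linked_def
  by (rule rtranclp_mono[THEN predicate2D, rotated]) (use assms(1) in \<open>auto intro: order_trans\<close>)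

lemma linked_fat:
  assumes "V \<in> N k" "x \<in> fat k V" "y \<in> fat k V"
  shows "linked k x y"
  unfolding linked_def block_def using assms by (intro r_into_rtranclp) blast

lemma envelope_superset: "V \<subseteq> envelope k V"
  unfolding envelope_def linked_def by auto

lemma envelope_diam:
  assumes "V \<in> N k" "x \<in> envelope k V" "y \<in> envelope k V"
  shows "\<rho> x y \<le> 2 * \<tau> k"
proof -
  obtain v w where v: "v \<in> V" "linked (Suc k) v x" and w: "w \<in> V" "linked (Suc k) w y"
    using assms unfolding envelope_def by blast
  have "\<eta> * \<tau> k \<le> \<tau> k"
    using \<eta> \<tau>_pos[of k] by auto
  then show ?thesis
    using linked_bound[OF v(2)] linked_bound[OF w(2)] diam[OF assms(1) v(1) w(1)] \<tau>_Suc[of k]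
      tri[of x y v] tri[of v y w] sym[of x v] \<tau>_pos[of k] by linarith
qed

text \<open>A common point would bring the two members within \<open>\<eta> * \<tau> k / 4\<close>
  of each other, less than their separation.\<close>

lemma envelope_unique:
  assumes "V \<in> N k" "W \<in> N k" "x \<in> envelope k V" "x \<in> envelope k W"
  shows "V = W"
proof (rule ccontr)
  assume "V \<noteq> W"
  obtain v w where v: "v \<in> V" "linked (Suc k) v x" and w: "w \<in> W" "linked (Suc k) w x"
    using assms unfolding envelope_def by blast
  have "0 < \<eta> * \<tau> k"
    using \<eta> \<tau>_pos[of k] by auto
  then show False
    using linked_bound[OF v(2)] linked_bound[OF w(2)] sep[OF assms(1,2) \<open>V \<noteq> W\<close> v(1) w(1)]
      \<tau>_Suc[of k] tri[of v w x] sym[of x w] by linarith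
qed

text \<open>The margin comes from the fattening: \<open>z\<close> is within
  \<open>\<eta> * \<tau> l / 4\<close> of a point of \<open>W\<close>, hence in
  \<open>fat l W\<close>, and this block of level \<open>l > k\<close> links \<open>z\<close>
  through \<open>x\<close> to \<open>V\<close>.\<close>

lemma envelope_absorbs:
  assumes "k < l" "V \<in> N k" "W \<in> N l" "x \<in> envelope k V" "x \<in> envelope l W"
    and "y \<in> envelope l W" "\<rho> y z \<le> \<eta> * \<tau> l / 8"
  shows "z \<in> envelope k V"
proof -
  obtain v w u where v: "v \<in> V" "linked (Suc k) v x" and w: "w \<in> W" "linked (Suc l) w x"
    and u: "u \<in> W" "linked (Suc l) u y"
    using assms unfolding envelope_def by blast
  have "\<rho> u z \<le> \<eta> * \<tau> l / 4"
    using tri[of u z y] linked_bound[OF u(2)] assms(7) \<tau>_Suc[of l] by linarith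
  then have "z \<in> fat l W"
    unfolding fat_def using u(1) by blast
  then have "linked l w z"
    using linked_fat[OF assms(3)] w(1) fat_superset by blast
  then have "linked (Suc k) w z"
    using assms(1) by (intro linked_antimono[of "Suc k" l]) auto
  moreover have "linked (Suc k) x w"
    using assms(1) linked_sym[OF linked_antimono[OF _ w(2), of "Suc k"]] by simp
  ultimately show ?thesis
    unfolding envelope_def using v linked_trans by blast
qed

text \<open>The branch of \<open>x\<close>, cut off at level \<open>\<kappa> x\<close>. Vertices
  carry their level because one set may be a member at several levels.\<close>

definition nest :: "('a \<Rightarrow> nat) \<Rightarrow> 'a \<Rightarrow> (nat \<times> 'a set) set" where
  "nest \<kappa> x = {(k, V). k \<le> \<kappa> x \<and> V \<in> N k \<and> x \<in> envelope k V}"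

lemma nest_unique: "(k, V) \<in> nest \<kappa> x \<Longrightarrow> (k, W) \<in> nest \<kappa> x \<Longrightarrow> V = W"
  unfolding nest_def using envelope_unique by blast

lemma inj_on_fst_nest: "inj_on fst (nest \<kappa> x)"
  using nest_unique by (fastforce intro: inj_onI)

lemma finite_nest: "finite (nest \<kappa> x)"
proof (rule inj_on_finite[OF inj_on_fst_nest])
  show "fst ` nest \<kappa> x \<subseteq> {..\<kappa> x}"
    unfolding nest_def by auto
qed simp

text \<open>A point \<open>y\<close> near the envelope of a finer vertex inherits the coarser
  vertices although it may miss the finer one.\<close>

lemma nest_absorbs:
  assumes "(k, V) \<in> nest \<kappa> x" "(l, W) \<in> nest \<kappa> x" "k < l" "k \<le> \<kappa> y"
    and "x' \<in> envelope l W" "\<rho> x' y \<le> \<eta> * \<tau> l / 8"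
  shows "(k, V) \<in> nest \<kappa> y"
  using assms envelope_absorbs[OF assms(3), of V W x x' y] unfolding nest_def by auto

text \<open>Branches share initial segments: this is absorption with margin zero, \<open>y\<close>
  itself lying in the finer envelope.\<close>

lemma nest_initial:
  assumes "(k, V) \<in> nest \<kappa> x" "(l, W) \<in> nest \<kappa> x" "(l, W) \<in> nest \<kappa> y" "k \<le> l"
  shows "(k, V) \<in> nest \<kappa> y"
proof (cases "k = l")
  case True
  then show ?thesis using assms nest_unique by blast
next
  case False
  have "0 \<le> \<eta> * \<tau> l / 8" using \<eta> \<tau>_pos[of l] by auto
  then show ?thesis
    using assms False by (intro nest_absorbs[of k V \<kappa> x l W y y]) (auto simp: nest_def)
qed

text \<open>Both intersections are initial segments of the branch of \<open>y\<close>, hence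
  comparable. This is what \<open>tree_of_nested_sets\<close> asks for.\<close>

lemma nest_nested: "nest \<kappa> x \<inter> nest \<kappa> y \<subseteq> nest \<kappa> z \<or> nest \<kappa> y \<inter> nest \<kappa> z \<subseteq> nest \<kappa> x"
proof (rule ccontr)
  assume "\<not> ?thesis"
  then obtain k V l W where
    "(k, V) \<in> nest \<kappa> x" "(k, V) \<in> nest \<kappa> y" "(k, V) \<notin> nest \<kappa> z"
    "(l, W) \<in> nest \<kappa> y" "(l, W) \<in> nest \<kappa> z" "(l, W) \<notin> nest \<kappa> x"
    by auto
  then show False
    using nest_initial[of k V \<kappa> y l W z] nest_initial[of l W \<kappa> y k V x] by linarith
qed

lemma nest_common_imp_close:
  "(k, V) \<in> nest \<kappa> x \<Longrightarrow> (k, V) \<in> nest \<kappa> y \<Longrightarrow> \<rho> x y \<le> 2 * \<tau> k"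
  unfolding nest_def using envelope_diam by auto

end

section \<open>The boundary map\<close>

lemma gromov_prod_commute: "gromov_prod p x y = gromov_prod p y x"
  unfolding gromov_prod_def by (simp add: dist_commute)

lemma gromov_prod_nonneg: "0 \<le> gromov_prod p x y"
  using dist_triangle[of x y p] unfolding gromov_prod_def by (simp add: dist_commute)

lemma gromov_prod_le: "gromov_prod p x y \<le> dist x p" "gromov_prod p x y \<le> dist y p"
  using dist_triangle[of x p y] dist_triangle[of y p x]
  unfolding gromov_prod_def by (simp_all add: dist_commute)

lemma gromov_prod_change_base: "\<bar>gromov_prod p x y - gromov_prod q x y\<bar> \<le> dist p q"
  using dist_triangle[of x p q] dist_triangle[of x q p] dist_triangle[of y p q] dist_triangle[of y q p]
  unfolding gromov_prod_def by (simp add: dist_commute abs_le_iff field_simps)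

text \<open>The visual metric brings its own base point; moving to it changes each product by at
  most \<open>dist p q\<close>.\<close>

lemma gromov_hyperbolic_at:
  fixes p :: "'a::metric_space"
  assumes "gromov_hyperbolic TYPE('a)"
  obtains \<delta> where "0 \<le> \<delta>"
    "\<And>x y z. min (gromov_prod p x y) (gromov_prod p y z) - \<delta> \<le> gromov_prod p x z"
proof -
  obtain \<delta> and q :: 'a where \<delta>: "0 \<le> \<delta>"
    and hyp: "\<And>x y z. min (gromov_prod q x y) (gromov_prod q y z) - \<delta> \<le> gromov_prod q x z"
    using assms unfolding gromov_hyperbolic_def by blast
  have "min (gromov_prod p x y) (gromov_prod p y z) - (\<delta> + 2 * dist p q) \<le> gromov_prod p x z" for x y z
    using hyp[of x y z] gromov_prod_change_base[of p x y q] gromov_prod_change_base[of p y z q]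
      gromov_prod_change_base[of p x z q] by linarith
  moreover have "0 \<le> \<delta> + 2 * dist p q" using \<delta> by simp
  ultimately show ?thesis using that by blast
qed

lemma bdry_nonempty:
  assumes "\<xi> \<in> bdry b"
  obtains u where "u \<in> \<xi>"
proof -
  obtain x where x: "\<xi> = {y. conv_inf b y \<and> seq_equiv b x y}" "conv_inf b x"
    using assms unfolding bdry_def by blast
  then have "x \<in> \<xi>"
    unfolding conv_inf_def seq_equiv_def by blast
  then show ?thesis using that by blast
qed

text \<open>A sequence representing \<open>\<xi> x\<close> eventually has product about
  \<open>dist x p\<close> with \<open>x\<close>. Hyperbolicity along representatives then compares
  the product of \<open>\<xi> x\<close> and \<open>\<xi> y\<close> with that of \<open>x\<close> and
  \<open>y\<close>; only the upper estimate needs the latter to stay well below both distances to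
  \<open>p\<close>.\<close>

lemma visual_boundary_map:
  fixes b :: "'a::metric_space" and d :: "(nat \<Rightarrow> 'a) set \<Rightarrow> (nat \<Rightarrow> 'a) set \<Rightarrow> real"
  assumes hyperbolic: "gromov_hyperbolic TYPE('a)"
    and visual: "visual_space b"
    and metric: "visual_metric b d"
  obtains p :: 'a and a A B D :: real and \<xi> :: "'a \<Rightarrow> (nat \<Rightarrow> 'a) set"
  where "1 < a" "0 < A" "0 < B" "\<And>x. \<xi> x \<in> bdry b"
    "\<And>x y. d (\<xi> x) (\<xi> y) \<le> A * a powr - gromov_prod p x y"
    "\<And>x y. min (dist x p) (dist y p) - D \<le> gromov_prod p x y \<or>
             B * a powr - gromov_prod p x y \<le> d (\<xi> x) (\<xi> y)"
proof -
  obtain p :: 'a and a c1 c2 where c: "1 < a" "0 < c1" "0 < c2"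
    and d: "\<And>\<xi> \<eta>. \<xi> \<in> bdry b \<Longrightarrow> \<eta> \<in> bdry b \<Longrightarrow>
        c1 * exp_neg a (gromov_prod_bdry p \<xi> \<eta>) \<le> d \<xi> \<eta> \<and>
        d \<xi> \<eta> \<le> c2 * exp_neg a (gromov_prod_bdry p \<xi> \<eta>)"
    using metric unfolding visual_metric_def by blast
  obtain \<delta> where \<delta>: "0 \<le> \<delta>"
    and hyp: "\<And>x y z. min (gromov_prod p x y) (gromov_prod p y z) - \<delta> \<le> gromov_prod p x z"
    using gromov_hyperbolic_at[OF hyperbolic, of p] by blast
  have hyp4: "min (gromov_prod p x y) (min (gromov_prod p y z) (gromov_prod p z w)) - 2 * \<delta>
      \<le> gromov_prod p x w" for x y z w
    using hyp[of x y w] hyp[of y z w] \<delta> by linarith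
  obtain q :: 'a and D where "0 < D"
    and vis: "\<forall>x. \<exists>\<xi>\<in>bdry b. ereal (dist x q) \<le> gromov_prod_pt_bdry q x \<xi> + ereal D"
    using visual unfolding visual_space_def by blast
  from vis obtain \<xi> where \<xi>: "\<And>x. \<xi> x \<in> bdry b"
    and vis': "\<And>x. ereal (dist x q) \<le> gromov_prod_pt_bdry q x (\<xi> x) + ereal D"
    by metis
  \<comment> \<open>\<open>D\<close> comes from visuality, \<open>1\<close> makes the inequality
    strict so that it passes from the \<open>liminf\<close> to almost all indices, and
    \<open>2 * dist p q\<close> pays for changing the base point.\<close>
  define C where "C = D + 1 + 2 * dist p q"
  have near: "\<forall>\<^sub>F i in sequentially. dist x p - C \<le> gromov_prod p x (u i)" if "u \<in> \<xi> x" for x u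
  proof -
    have "gromov_prod_pt_bdry q x (\<xi> x) \<le> liminf (\<lambda>i. ereal (gromov_prod q x (u i)))"
      unfolding gromov_prod_pt_bdry_def using that by (intro Inf_lower) blast
    then have "ereal (dist x q) \<le> liminf (\<lambda>i. ereal (gromov_prod q x (u i))) + ereal D"
      using vis'[of x] by (meson add_right_mono order_trans)
    then have "ereal (dist x q - D - 1) < liminf (\<lambda>i. ereal (gromov_prod q x (u i)))"
      by (cases "liminf (\<lambda>i. ereal (gromov_prod q x (u i)))") auto
    then have "\<forall>\<^sub>F i in sequentially. ereal (dist x q - D - 1) < ereal (gromov_prod q x (u i))"
      by (rule less_LiminfD)
    then show ?thesis
    proof eventually_elim
      case (elim i)
      then show ?case
        using gromov_prod_change_base[of p x "u i" q] dist_triangle[of x p q]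
        unfolding C_def by (simp add: dist_commute)
    qed
  qed
  \<comment> \<open>Hyperbolicity along \<open>u i, x, y, v i\<close>; the outer products are at
    least \<open>gromov_prod p x y - C\<close>.\<close>
  have lower: "ereal (gromov_prod p x y - C - 2 * \<delta>) \<le> gromov_prod_bdry p (\<xi> x) (\<xi> y)" for x y
    unfolding gromov_prod_bdry_def
  proof (rule Inf_greatest)
    fix L assume "L \<in> {liminf (\<lambda>i. ereal (gromov_prod p (u i) (v i))) |u v. u \<in> \<xi> x \<and> v \<in> \<xi> y}"
    then obtain u v where uv: "u \<in> \<xi> x" "v \<in> \<xi> y"
      and L: "L = liminf (\<lambda>i. ereal (gromov_prod p (u i) (v i)))" by blast
    have C: "0 \<le> C" using \<open>0 < D\<close> unfolding C_def by simp
    have "\<forall>\<^sub>F i in sequentially. ereal (gromov_prod p x y - C - 2 * \<delta>) \<le> ereal (gromov_prod p (u i) (v i))"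
      using near[OF uv(1)] near[OF uv(2)]
    proof eventually_elim
      case (elim i)
      then show ?case
        using hyp4[of "u i" x y "v i"] gromov_prod_le[of p x y] gromov_prod_commute[of p x "u i"] C
        unfolding ereal_less_eq by linarith
    qed
    then show "ereal (gromov_prod p x y - C - 2 * \<delta>) \<le> L"
      unfolding L by (rule Liminf_bounded)
  qed
  \<comment> \<open>Hyperbolicity along \<open>x, u i, v i, y\<close>: by \<open>far\<close> the
    outer products are too large to be the minimum. One pair of representatives suffices, the
    boundary product being an infimum.\<close>
  have upper: "gromov_prod_bdry p (\<xi> x) (\<xi> y) \<le> ereal (gromov_prod p x y + 2 * \<delta>)"
    if far: "gromov_prod p x y < min (dist x p) (dist y p) - (C + 2 * \<delta>)" for x y
  proof -
    obtain u v where uv: "u \<in> \<xi> x" "v \<in> \<xi> y"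
      using bdry_nonempty \<xi> by metis
    have "\<forall>\<^sub>F i in sequentially. ereal (gromov_prod p (u i) (v i)) \<le> ereal (gromov_prod p x y + 2 * \<delta>)"
      using near[OF uv(1)] near[OF uv(2)]
    proof eventually_elim
      case (elim i)
      then show ?case
        using hyp4[of x "u i" "v i" y] gromov_prod_commute[of p y "v i"] far
        unfolding ereal_less_eq by linarith
    qed
    then have "liminf (\<lambda>i. ereal (gromov_prod p (u i) (v i))) \<le> ereal (gromov_prod p x y + 2 * \<delta>)"
      by (intro Liminf_le) auto
    moreover have "gromov_prod_bdry p (\<xi> x) (\<xi> y) \<le> liminf (\<lambda>i. ereal (gromov_prod p (u i) (v i)))"
      unfolding gromov_prod_bdry_def using uv by (intro Inf_lower) blast
    ultimately show ?thesis by (rule order_trans[rotated])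
  qed
  define A where "A = c2 * a powr (C + 2 * \<delta>)"
  define B where "B = c1 * a powr (- 2 * \<delta>)"
  have "exp_neg a (gromov_prod_bdry p (\<xi> x) (\<xi> y)) \<le> a powr (C + 2 * \<delta> - gromov_prod p x y)" for x y
    using lower[of x y] c(1) unfolding exp_neg_def
    by (cases "gromov_prod_bdry p (\<xi> x) (\<xi> y)") (auto intro!: powr_mono)
  then have dA: "d (\<xi> x) (\<xi> y) \<le> A * a powr - gromov_prod p x y" for x y
    using d[OF \<xi>[of x] \<xi>[of y]] c unfolding A_def
    by (smt (verit, best) mult.assoc mult_left_mono powr_add)
  have dB: "min (dist x p) (dist y p) - (C + 2 * \<delta>) \<le> gromov_prod p x y \<or>
      B * a powr - gromov_prod p x y \<le> d (\<xi> x) (\<xi> y)" for x y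
  proof (rule disjCI)
    assume "\<not> B * a powr - gromov_prod p x y \<le> d (\<xi> x) (\<xi> y)"
    \<comment> \<open>\<open>upper\<close> excludes the product \<infinity>, and
      \<open>lower\<close> excludes -\<infinity>, where \<open>real_of_ereal\<close> would return
      \<open>0\<close>.\<close>
    moreover have "a powr (- 2 * \<delta> - gromov_prod p x y) \<le> exp_neg a (gromov_prod_bdry p (\<xi> x) (\<xi> y))"
      if "gromov_prod p x y < min (dist x p) (dist y p) - (C + 2 * \<delta>)"
      using lower[of x y] upper[OF that] c(1) unfolding exp_neg_def
      by (cases "gromov_prod_bdry p (\<xi> x) (\<xi> y)") (auto intro!: powr_mono)
    ultimately show "min (dist x p) (dist y p) - (C + 2 * \<delta>) \<le> gromov_prod p x y"
      using d[OF \<xi>[of x] \<xi>[of y]] c unfolding B_def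
      by (smt (verit, best) mult.assoc mult_left_mono powr_add)
  qed
  show ?thesis
    by (rule that[of a A B \<xi> p "C + 2 * \<delta>"]) (use c \<xi> dA dB in \<open>auto simp: A_def B_def\<close>)
qed

section \<open>Separated coloured coverings from the capacity dimension\<close>

definition separated_cover ::
    "'b set \<Rightarrow> ('b \<Rightarrow> 'b \<Rightarrow> real) \<Rightarrow> nat \<Rightarrow> real \<Rightarrow> real \<Rightarrow> (nat \<Rightarrow> 'b set set) \<Rightarrow> bool" where
  "separated_cover Z d n \<tau> \<epsilon> \<W> \<longleftrightarrow> (\<forall>z\<in>Z. \<exists>i<n. z \<in> \<Union>(\<W> i)) \<and>
     (\<forall>i<n. \<forall>V\<in>\<W> i. \<forall>v\<in>V. \<forall>w\<in>V. d v w \<le> \<tau>) \<and>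
     (\<forall>i<n. \<forall>V\<in>\<W> i. \<forall>W\<in>\<W> i. V \<noteq> W \<longrightarrow> (\<forall>v\<in>V. \<forall>w\<in>W. \<epsilon> \<le> d v w))"

lemma separated_coverD:
  assumes "separated_cover Z d n \<tau> \<epsilon> \<W>"
  shows "z \<in> Z \<Longrightarrow> \<exists>i<n. z \<in> \<Union>(\<W> i)"
    and "i < n \<Longrightarrow> V \<in> \<W> i \<Longrightarrow> v \<in> V \<Longrightarrow> w \<in> V \<Longrightarrow> d v w \<le> \<tau>"
    and "i < n \<Longrightarrow> V \<in> \<W> i \<Longrightarrow> W \<in> \<W> i \<Longrightarrow> V \<noteq> W \<Longrightarrow> v \<in> V \<Longrightarrow> w \<in> W \<Longrightarrow> \<epsilon> \<le> d v w"
  using assms unfolding separated_cover_def by simp_all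

text \<open>Each \<open>U\<close> is shrunk to its points of depth greater than
  \<open>\<delta> * \<tau> / 2\<close>. The Lebesgue number keeps the cores a covering, and cores of
  disjoint sets are at least that far apart.\<close>

lemma cdim_le_imp_separated_cover:
  assumes met: "metric_on Z d" and dim: "cdim_le Z d m"
  obtains \<eta> \<tau>0 :: real where "0 < \<eta>" "\<eta> \<le> 1" "0 < \<tau>0"
    "\<And>\<tau>. 0 < \<tau> \<Longrightarrow> \<tau> \<le> \<tau>0 \<Longrightarrow> \<exists>\<W>. separated_cover Z d (m + 1) \<tau> (\<eta> * \<tau>) \<W>"
proof -
  obtain \<delta> \<tau>0 where pos: "0 < \<delta>" "0 < \<tau>0"
    and cov: "\<And>\<tau>. 0 < \<tau> \<Longrightarrow> \<tau> \<le> \<tau>0 \<Longrightarrow> \<exists>\<U>. open_covering Z d \<U> \<and> colored (m + 1) \<U> \<and>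
            mesh d \<U> \<le> ereal \<tau> \<and> ereal (\<delta> * \<tau>) \<le> lebesgue_num Z d \<U>"
    using dim unfolding cdim_le_def by blast
  \<comment> \<open>Halving \<open>\<delta>\<close> leaves room for a supremum that need not be
    attained; the cap \<open>1\<close> is required by \<open>separated_families\<close>.\<close>
  define \<eta> where "\<eta> = min 1 (\<delta> / 2)"
  have "\<exists>\<W>. separated_cover Z d (m + 1) \<tau> (\<eta> * \<tau>) \<W>"
    if \<tau>: "0 < \<tau>" "\<tau> \<le> \<tau>0" for \<tau>
  proof -
    obtain \<U> where \<U>: "colored (m + 1) \<U>" "mesh d \<U> \<le> ereal \<tau>" "ereal (\<delta> * \<tau>) \<le> lebesgue_num Z d \<U>"
      using cov[OF \<tau>] by blast
    obtain \<V> where \<V>: "\<U> = (\<Union>i<m + 1. \<V> i)" "\<And>i. i < m + 1 \<Longrightarrow> disjoint (\<V> i)"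
      using \<U>(1) unfolding colored_def by blast
    define core where "core U = {z \<in> Z. ereal (\<delta> * \<tau> / 2) < setdist_on d z (Z - U)}" for U
    have core: "\<delta> * \<tau> / 2 < d z w" if "z \<in> core U" "w \<in> Z" "w \<notin> U" for z w U
    proof -
      have "setdist_on d z (Z - U) \<le> ereal (d z w)"
        unfolding setdist_on_def using that by (intro INF_lower) auto
      then have "ereal (\<delta> * \<tau> / 2) < ereal (d z w)"
        using that(1) less_le_trans unfolding core_def by blast
      then show ?thesis by simp
    qed
    have core_sub: "core U \<subseteq> U" for U
    proof
      fix z assume z: "z \<in> core U"
      then have "z \<in> Z" unfolding core_def by simp
      then have "d z z = 0" using met unfolding metric_on_def by blast
      then show "z \<in> U"
        using core[OF z \<open>z \<in> Z\<close>] mult_pos_pos[OF pos(1) \<tau>(1)] by force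
    qed
    have "\<exists>i<m + 1. z \<in> \<Union>(core ` \<V> i)" if "z \<in> Z" for z
    proof -
      have "ereal (\<delta> * \<tau>) \<le> lebesgue_at Z d \<U> z"
        using \<U>(3) that unfolding lebesgue_num_def by (meson INF_lower order_trans)
      then have "ereal (\<delta> * \<tau>) \<le> (SUP U\<in>\<U>. setdist_on d z (Z - U))"
        unfolding lebesgue_at_def by simp
      moreover have "ereal (\<delta> * \<tau> / 2) < ereal (\<delta> * \<tau>)"
        using pos \<tau>(1) by simp
      ultimately have "ereal (\<delta> * \<tau> / 2) < (SUP U\<in>\<U>. setdist_on d z (Z - U))"
        by (rule less_le_trans[rotated])
      then obtain U where "U \<in> \<U>" "ereal (\<delta> * \<tau> / 2) < setdist_on d z (Z - U)"
        unfolding less_SUP_iff by blast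
      then show ?thesis
        using that \<V>(1) unfolding core_def by blast
    qed
    moreover have "d v w \<le> \<tau>" if i: "i < m + 1" "V \<in> core ` \<V> i" "v \<in> V" "w \<in> V" for i V v w
    proof -
      obtain U where "U \<in> \<V> i" "V = core U"
        using i(2) by (rule imageE)
      then have U: "U \<in> \<U>" "v \<in> U" "w \<in> U"
        using i(1,3,4) core_sub[of U] \<V>(1) by auto
      have "ereal (d v w) \<le> diam_on d U"
        unfolding diam_on_def using U by (intro Sup_upper) blast
      also have "\<dots> \<le> mesh d \<U>"
        unfolding mesh_def using U by (intro SUP_upper)
      also note \<U>(2)
      finally show ?thesis by simp
    qed
    moreover have "\<eta> * \<tau> \<le> d v w"
      if i: "i < m + 1" "V \<in> core ` \<V> i" "W \<in> core ` \<V> i" "V \<noteq> W" "v \<in> V" "w \<in> W" for i V W v w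
    proof -
      obtain U U' where U: "U \<in> \<V> i" "U' \<in> \<V> i" "V = core U" "W = core U'"
        using i(2,3) by (elim imageE)
      have "U \<inter> U' = {}"
        using disjointD[OF \<V>(2)[OF i(1)] U(1,2)] U i(4) by blast
      then have "w \<notin> U" "w \<in> Z"
        using core_sub[of U'] i(6) U(4) unfolding core_def by auto
      then have "\<delta> * \<tau> / 2 < d v w"
        using core i(5) U(3) by blast
      moreover have "\<eta> * \<tau> \<le> \<delta> / 2 * \<tau>"
        unfolding \<eta>_def using \<tau>(1) by (intro mult_right_mono) auto
      ultimately show ?thesis by simp
    qed
    ultimately show ?thesis
      unfolding separated_cover_def
      by (intro exI[of _ "\<lambda>i. core ` \<V> i"] conjI ballI allI impI) assumption+
  qed
  moreover have "0 < \<eta>" "\<eta> \<le> 1"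
    unfolding \<eta>_def using pos by auto
  ultimately show ?thesis
    using that pos(2) by blast
qed

section \<open>The embedding\<close>

lemma card_nat_set_le:
  fixes \<alpha> \<beta> :: real
  assumes "finite K" "\<And>k. k \<in> K \<Longrightarrow> \<alpha> < real k \<and> real k \<le> \<beta>" "\<alpha> \<le> \<beta>"
  shows "real (card K) \<le> \<beta> - \<alpha> + 1"
proof (cases "K = {}")
  case False
  have "K \<subseteq> {Min K..Max K}"
    using assms(1) by auto
  then have "card K \<le> Suc (Max K) - Min K"
    using card_mono[of "{Min K..Max K}" K] by simp
  moreover have "Min K \<le> Max K"
    using assms(1) False by simp
  moreover have "\<alpha> < real (Min K)" "real (Max K) \<le> \<beta>"
    using assms(1,2) False by simp_all
  ultimately show ?thesis by linarith
qed (use assms in auto)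

section \<open>Counting the levels at which two branches differ\<close>

context separated_families
begin

text \<open>By the margin, a level up to \<open>\<alpha>\<close> on the branch of \<open>x\<close>
  passes all coarser vertices on to \<open>y\<close>, so at most the coarsest missing level can be
  that low. The \<open>2\<close> accounts for this level and for rounding in the interval from
  \<open>\<alpha>\<close> to \<open>\<beta>\<close>.\<close>

lemma card_nest_diff_le:
  fixes \<alpha> \<beta> :: real
  assumes close: "\<And>l. real l \<le> \<alpha> \<Longrightarrow> l \<le> \<kappa> y \<and> \<rho> x y \<le> \<eta> * \<tau> l / 8"
    and "real (\<kappa> x) \<le> \<beta>" "\<alpha> \<le> \<beta>"
  shows "real (card (nest \<kappa> x - nest \<kappa> y)) \<le> \<beta> - \<alpha> + 2"
proof -
  define K where "K = fst ` (nest \<kappa> x - nest \<kappa> y)"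
  have fin: "finite K"
    unfolding K_def using finite_nest by blast
  have card_K: "card (nest \<kappa> x - nest \<kappa> y) = card K"
    unfolding K_def using inj_on_subset[OF inj_on_fst_nest] by (intro card_image[symmetric]) blast
  have K: "\<exists>V. (k, V) \<in> nest \<kappa> x \<and> (k, V) \<notin> nest \<kappa> y" if "k \<in> K" for k
    using that unfolding K_def by force
  have "\<alpha> < real l \<and> real l \<le> \<beta>" if l: "l \<in> K - {Min K}" for l
  proof
    have "Min K \<in> K" "Min K < l"
      using l fin by (auto intro!: Min_in simp: less_le)
    then obtain V W where VW: "(Min K, V) \<in> nest \<kappa> x" "(Min K, V) \<notin> nest \<kappa> y" "(l, W) \<in> nest \<kappa> x"
      using K[of "Min K"] K[of l] l by blast
    show "real l \<le> \<beta>"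
      using VW(3) assms(2) unfolding nest_def by auto
    show "\<alpha> < real l"
    proof (rule ccontr)
      assume "\<not> \<alpha> < real l"
      then have "l \<le> \<kappa> y" "\<rho> x y \<le> \<eta> * \<tau> l / 8"
        using close[of l] by auto
      then have "(Min K, V) \<in> nest \<kappa> y"
        using VW(1,3) \<open>Min K < l\<close>
        by (intro nest_absorbs[OF VW(1,3), where x' = x]) (auto simp: nest_def)
      then show False using VW(2) by blast
    qed
  qed
  then have "real (card (K - {Min K})) \<le> \<beta> - \<alpha> + 1"
    using fin assms(3) by (intro card_nat_set_le) auto
  moreover have "card K \<le> card (K - {Min K}) + 1"
    using card_Suc_Diff1[OF fin, of "Min K"] by (cases "Min K \<in> K") auto
  ultimately show ?thesis
    unfolding card_K by linarith
qed

end

text \<open>At every level above \<open>\<theta>\<close> and up to \<open>\<kappa> x\<close> some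
  colour covers \<open>x\<close>. That vertex is not on the branch of \<open>y\<close>, which is
  either too short or too far away to share it.\<close>

lemma sum_card_nest_diff_ge:
  fixes N :: "nat \<Rightarrow> nat \<Rightarrow> 'a set set" and \<theta> :: real
  assumes fam: "\<And>i. i < n \<Longrightarrow> separated_families \<rho> (N i) \<tau> \<eta>"
    and cover: "\<And>k x. \<exists>i<n. x \<in> \<Union>(N i k)"
    and "0 \<le> \<theta>"
    and apart: "\<And>k. \<theta> < real k \<Longrightarrow> \<kappa> y < k \<or> 2 * \<tau> k < \<rho> x y"
  shows "real (\<kappa> x) - \<theta> \<le> (\<Sum>i<n. real (card
    (separated_families.nest \<rho> (N i) \<tau> \<eta> \<kappa> x - separated_families.nest \<rho> (N i) \<tau> \<eta> \<kappa> y)))"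
proof -
  define E where "E i = separated_families.nest \<rho> (N i) \<tau> \<eta> \<kappa> x -
    separated_families.nest \<rho> (N i) \<tau> \<eta> \<kappa> y" for i
  have fin: "finite (E i)" if "i < n" for i
    unfolding E_def using separated_families.finite_nest[OF fam[OF that]] by blast
  have "{nat \<lfloor>\<theta>\<rfloor> + 1..\<kappa> x} \<subseteq> (\<Union>i<n. fst ` E i)"
  proof
    fix k assume k: "k \<in> {nat \<lfloor>\<theta>\<rfloor> + 1..\<kappa> x}"
    then have "\<theta> < real k"
      using \<open>0 \<le> \<theta>\<close> by auto linarith
    then have far: "\<kappa> y < k \<or> 2 * \<tau> k < \<rho> x y"
      by (rule apart)
    obtain i V where i: "i < n" "V \<in> N i k" "x \<in> V"
      using cover by blast
    interpret separated_families \<rho> "N i" \<tau> \<eta>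
      by (rule fam[OF i(1)])
    have "(k, V) \<in> nest \<kappa> x"
      using k i envelope_superset unfolding nest_def by auto
    moreover have "(k, V) \<notin> nest \<kappa> y"
      using far nest_common_imp_close[OF calculation] unfolding nest_def by fastforce
    ultimately have "(k, V) \<in> E i"
      unfolding E_def by blast
    then show "k \<in> (\<Union>i<n. fst ` E i)"
      using i(1) by force
  qed
  then have "card {nat \<lfloor>\<theta>\<rfloor> + 1..\<kappa> x} \<le> card (\<Union>i<n. fst ` E i)"
    using fin by (intro card_mono) auto
  also have "\<dots> \<le> (\<Sum>i<n. card (fst ` E i))"
    by (rule card_UN_le) simp
  also have "\<dots> \<le> (\<Sum>i<n. card (E i))"
    using fin by (intro sum_mono card_image_le) auto
  finally have "real (\<kappa> x - nat \<lfloor>\<theta>\<rfloor>) \<le> real (\<Sum>i<n. card (E i))"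
    unfolding of_nat_le_iff by simp
  moreover have "real (\<kappa> x) - \<theta> \<le> real (\<kappa> x - nat \<lfloor>\<theta>\<rfloor>)"
    using \<open>0 \<le> \<theta>\<close> by linarith
  ultimately show ?thesis
    unfolding E_def by simp
qed

text \<open>The \<open>L2_set\<close> norm lies between the sum of the coordinates divided by
  \<open>n\<close> and the sum itself.\<close>

lemma qi_embedding_prod_distI:
  fixes f :: "'a::metric_space \<Rightarrow> nat \<Rightarrow> 'b"
  assumes "0 < n" "0 < \<omega>" "0 \<le> E" "0 \<le> E'"
    and nonneg: "\<And>i x y. i < n \<Longrightarrow> 0 \<le> dT i (f x i) (f y i)"
    and upper: "\<And>i x y. i < n \<Longrightarrow> dT i (f x i) (f y i) \<le> dist x y / \<omega> + E"
    and lower: "\<And>x y. dist x y / \<omega> - E' \<le> (\<Sum>i<n. dT i (f x i) (f y i))"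
  shows "qi_embedding dist (prod_dist n dT) f"
proof -
  \<comment> \<open>\<open>real n / \<omega>\<close> serves the upper estimate and
    \<open>real n * \<omega>\<close> the lower one.\<close>
  define \<Lambda> where "\<Lambda> = 1 + real n / \<omega> + real n * \<omega>"
  define \<sigma> where "\<sigma> = real n * E + E'"
  have "dist x y / \<Lambda> - \<sigma> \<le> prod_dist n dT (f x) (f y)"
    and "prod_dist n dT (f x) (f y) \<le> \<Lambda> * dist x y + \<sigma>" for x y
  proof -
    let ?r = "\<lambda>i. dT i (f x i) (f y i)"
    have eq: "prod_dist n dT (f x) (f y) = L2_set ?r {..<n}"
      unfolding prod_dist_def L2_set_def ..
    have "?r i \<le> L2_set ?r {..<n}" if "i < n" for i
      using that by (intro member_le_L2_set) auto
    then have "(\<Sum>i<n. ?r i) \<le> real n * L2_set ?r {..<n}"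
      using sum_bounded_above[of "{..<n}" ?r "L2_set ?r {..<n}"] by simp
    then have "(dist x y / \<omega> - E') / real n \<le> L2_set ?r {..<n}"
      using lower[of x y] \<open>0 < n\<close> by (simp add: field_simps)
    moreover have "dist x y / \<Lambda> \<le> dist x y / (real n * \<omega>)"
      using assms(1,2) unfolding \<Lambda>_def by (intro divide_left_mono) (auto intro!: mult_pos_pos add_pos_pos)
    moreover have "E' / real n \<le> \<sigma>"
    proof -
      have "E' / real n \<le> E' / 1"
        using assms(1,4) by (intro divide_left_mono) auto
      then show ?thesis unfolding \<sigma>_def using assms(3) by (simp add: add_increasing)
    qed
    ultimately show "dist x y / \<Lambda> - \<sigma> \<le> prod_dist n dT (f x) (f y)"
      unfolding eq by (simp add: diff_divide_distrib mult.commute)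
    have "L2_set ?r {..<n} \<le> (\<Sum>i<n. ?r i)"
      using nonneg by (intro L2_set_le_sum) auto
    also have "\<dots> \<le> real n * (dist x y / \<omega> + E)"
      using sum_bounded_above[of "{..<n}" ?r "dist x y / \<omega> + E"] upper by simp
    also have "\<dots> = real n / \<omega> * dist x y + real n * E"
      by (simp add: algebra_simps)
    also have "\<dots> \<le> \<Lambda> * dist x y + \<sigma>"
      unfolding \<Lambda>_def \<sigma>_def using assms(1-4) by (intro add_mono mult_right_mono) auto
    finally show "prod_dist n dT (f x) (f y) \<le> \<Lambda> * dist x y + \<sigma>"
      unfolding eq .
  qed
  moreover have "1 \<le> \<Lambda>" "0 \<le> \<sigma>"
    unfolding \<Lambda>_def \<sigma>_def using assms(1-4) by auto
  ultimately show ?thesis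
    unfolding qi_embedding_def by blast
qed

theorem theorem1p1:
  fixes b :: "'a::metric_space" and d :: "(nat \<Rightarrow> 'a) set \<Rightarrow> (nat \<Rightarrow> 'a) set \<Rightarrow> real"
  assumes "gromov_hyperbolic TYPE('a)"
    and "visual_space b"
    and "visual_metric b d"
    and "cdim (bdry b) d < \<infinity>"
  shows "\<exists>(T :: nat \<Rightarrow> ('a \<times> real) set) dT (f :: 'a \<Rightarrow> nat \<Rightarrow> 'a \<times> real).
           (\<forall>i < the_enat (cdim (bdry b) d) + 1. metric_tree (T i) (dT i)) \<and>
           (\<forall>x. \<forall>i < the_enat (cdim (bdry b) d) + 1. f x i \<in> T i) \<and>
           qi_embedding dist (prod_dist (the_enat (cdim (bdry b) d) + 1) dT) f"
proof -
  define n where "n = the_enat (cdim (bdry b) d) + 1"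
  have "\<exists>m. cdim_le (bdry b) d m"
    using assms(4) unfolding cdim_def by (auto split: if_splits)
  then have dim: "cdim_le (bdry b) d (the_enat (cdim (bdry b) d))"
    unfolding cdim_def using LeastI_ex[of "cdim_le (bdry b) d"] by simp
  have met: "metric_on (bdry b) d"
    using assms(3) unfolding visual_metric_def by blast
  obtain p :: 'a and a A B D \<xi> where a: "1 < a" and AB: "0 < A" "0 < B" and \<xi>: "\<And>x. \<xi> x \<in> bdry b"
    and dA: "\<And>x y. d (\<xi> x) (\<xi> y) \<le> A * a powr - gromov_prod p x y"
    and dB: "\<And>x y. min (dist x p) (dist y p) - D \<le> gromov_prod p x y \<or>
             B * a powr - gromov_prod p x y \<le> d (\<xi> x) (\<xi> y)"
    by (rule visual_boundary_map[OF assms(1-3)]) (rule that; fast)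
  obtain \<eta> \<tau>0 where \<eta>: "0 < \<eta>" "\<eta> \<le> 1" and \<tau>0: "0 < \<tau>0"
    and cov: "\<And>\<tau>. 0 < \<tau> \<Longrightarrow> \<tau> \<le> \<tau>0 \<Longrightarrow> \<exists>\<W>. separated_cover (bdry b) d n \<tau> (\<eta> * \<tau>) \<W>"
    using cdim_le_imp_separated_cover[OF met dim] unfolding n_def by blast
  \<comment> \<open>Chosen so that \<open>a powr (- \<omega>) = \<eta> / 16\<close>, the ratio of
    scales required for laminarity; one level of the tree then stands for the length
    \<open>\<omega>\<close>.\<close>
  define \<omega> where "\<omega> = log a (16 / \<eta>)"
  have \<omega>: "0 < \<omega>"
    unfolding \<omega>_def using a \<eta> by (simp add: field_simps)
  define \<tau> where "\<tau> k = \<tau>0 * a powr (- \<omega> * real k)" for k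
  have \<tau>: "0 < \<tau> k" "\<tau> k \<le> \<tau>0" for k
  proof -
    show "0 < \<tau> k" unfolding \<tau>_def using a \<tau>0 by simp
    have "a powr (- \<omega> * real k) \<le> a powr 0"
      using a \<omega> by (intro powr_mono) auto
    then show "\<tau> k \<le> \<tau>0" unfolding \<tau>_def using a \<tau>0 by simp
  qed
  have \<tau>_Suc: "\<tau> (Suc k) \<le> \<eta> / 16 * \<tau> k" for k
  proof -
    have "a powr (- \<omega>) = \<eta> / 16"
      unfolding \<omega>_def using a \<eta> by (simp add: powr_minus)
    moreover have "a powr (- \<omega> * real (Suc k)) = a powr (- \<omega>) * a powr (- \<omega> * real k)"
      unfolding powr_add[symmetric] by (simp add: algebra_simps)
    ultimately have "\<tau> (Suc k) = \<eta> / 16 * \<tau> k"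
      unfolding \<tau>_def by (simp only: mult.left_commute)
    then show ?thesis by simp
  qed
  have "\<forall>k. \<exists>\<W>. separated_cover (bdry b) d n (\<tau> k) (\<eta> * \<tau> k) \<W>"
    by (intro allI cov \<tau>)
  then obtain \<W> where "\<forall>k. separated_cover (bdry b) d n (\<tau> k) (\<eta> * \<tau> k) (\<W> k)"
    by (rule choice[THEN exE])
  then have \<W>: "separated_cover (bdry b) d n (\<tau> k) (\<eta> * \<tau> k) (\<W> k)" for k
    by blast
  \<comment> \<open>The coverings are pulled back to the space itself. As \<xi> need not be
    injective, \<open>\<rho>\<close> is only a pseudometric, which is all that
    \<open>separated_families\<close> assumes.\<close>
  define \<rho> where "\<rho> x y = d (\<xi> x) (\<xi> y)" for x y
  define N where "N i k = (\<lambda>V. \<xi> -` V) ` \<W> k i" for i k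
  have fam: "separated_families \<rho> (N i) \<tau> \<eta>" if "i < n" for i
  proof
    fix x y z k
    show "\<rho> x x = 0" "\<rho> x y = \<rho> y x" "\<rho> x z \<le> \<rho> x y + \<rho> y z"
      using met \<xi> unfolding \<rho>_def metric_on_def by blast+
    show "0 < \<eta>" "\<eta> \<le> 1" "0 < \<tau> k" "\<tau> (Suc k) \<le> \<eta> / 16 * \<tau> k"
      by (fact \<eta> \<tau> \<tau>_Suc)+
  next
    fix V k v w assume "V \<in> N i k" "v \<in> V" "w \<in> V"
    then obtain V' where "V' \<in> \<W> k i" "\<xi> v \<in> V'" "\<xi> w \<in> V'"
      unfolding N_def by blast
    then show "\<rho> v w \<le> \<tau> k"
      unfolding \<rho>_def by (rule separated_coverD(2)[OF \<W> that])
  next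
    fix V W k v w assume "V \<in> N i k" "W \<in> N i k" "V \<noteq> W" "v \<in> V" "w \<in> W"
    then obtain V' W' where "V' \<in> \<W> k i" "W' \<in> \<W> k i" "V' \<noteq> W'" "\<xi> v \<in> V'" "\<xi> w \<in> W'"
      unfolding N_def by blast
    then show "\<eta> * \<tau> k \<le> \<rho> v w"
      unfolding \<rho>_def by (rule separated_coverD(3)[OF \<W> that])
  qed
  have cover: "\<exists>i<n. x \<in> \<Union>(N i k)" for k x
  proof -
    obtain i V where "i < n" "V \<in> \<W> k i" "\<xi> x \<in> V"
      using separated_coverD(1)[OF \<W> \<xi>, of x k] by blast
    then show ?thesis
      unfolding N_def by (intro exI[of _ i]) auto
  qed
  define \<kappa> where "\<kappa> x = nat \<lfloor>dist x p / \<omega>\<rfloor>" for x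
  have \<kappa>_le: "real (\<kappa> x) \<le> dist x p / \<omega>" and \<kappa>_ge: "dist x p / \<omega> - 1 \<le> real (\<kappa> x)" for x
    using \<omega> unfolding \<kappa>_def by (auto simp: of_nat_floor)
  have le_\<kappa>: "k \<le> \<kappa> x" if "real k \<le> dist x p / \<omega>" for k x
    using that unfolding \<kappa>_def by (rule le_nat_floor)
  define S where "S i = separated_families.nest \<rho> (N i) \<tau> \<eta> \<kappa>" for i
  have "\<exists>(T :: ('a \<times> real) set) dT f. metric_tree T dT \<and> (\<forall>x. f x \<in> T) \<and>
           (\<forall>x y. dT (f x) (f y) = real (card (S i x - S i y)) + real (card (S i y - S i x)))"
    if "i < n" for i
    unfolding S_def using separated_families.finite_nest[OF fam[OF that]]
      separated_families.nest_nested[OF fam[OF that]]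
    by (rule tree_of_nested_sets)
  then obtain T :: "nat \<Rightarrow> ('a \<times> real) set" and dT F where tree: "\<And>i. i < n \<Longrightarrow> metric_tree (T i) (dT i)"
    "\<And>i x. i < n \<Longrightarrow> F i x \<in> T i"
    "\<And>i x y. i < n \<Longrightarrow> dT i (F i x) (F i y) = real (card (S i x - S i y)) + real (card (S i y - S i x))"
    by metis
  have dist_eq: "dist x y = dist x p + dist y p - 2 * gromov_prod p x y" for x y
    unfolding gromov_prod_def by (simp add: field_simps)

  \<comment> \<open>Ensures
    \<open>A * a powr - gromov_prod p x y \<le> \<eta> * \<tau> k / 8\<close> as soon as
    \<open>\<omega> * real k \<le> gromov_prod p x y - c\<close>; nonnegativity also puts such
    \<open>k\<close> below \<open>\<kappa> y\<close>.\<close>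
  define c where "c = max 0 (log a (8 * A / (\<eta> * \<tau>0)))"
  have c: "0 \<le> c" "A \<le> \<eta> * \<tau>0 / 8 * a powr c"
  proof -
    have "8 * A / (\<eta> * \<tau>0) = a powr (log a (8 * A / (\<eta> * \<tau>0)))"
      using a AB \<eta> \<tau>0 by simp
    also have "\<dots> \<le> a powr c"
      using a unfolding c_def by (intro powr_mono) auto
    finally show "A \<le> \<eta> * \<tau>0 / 8 * a powr c"
      using \<eta> \<tau>0 by (simp add: field_simps)
  qed (simp add: c_def)
  have card_le: "real (card (S i x - S i y)) \<le> (dist x p - gromov_prod p x y + c) / \<omega> + 2"
    if "i < n" for i x y
  proof -
    have close: "k \<le> \<kappa> y \<and> \<rho> x y \<le> \<eta> * \<tau> k / 8" if k: "real k \<le> (gromov_prod p x y - c) / \<omega>" for k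
    proof
      have k': "\<omega> * real k \<le> gromov_prod p x y - c"
        using k \<omega> by (simp add: field_simps)
      have "real k \<le> dist y p / \<omega>"
        using k' c(1) gromov_prod_le(2)[of p x y] \<omega> by (simp add: field_simps)
      then show "k \<le> \<kappa> y" by (rule le_\<kappa>)
      have "\<rho> x y \<le> A * a powr - gromov_prod p x y"
        unfolding \<rho>_def by (rule dA)
      also have "\<dots> \<le> \<eta> * \<tau>0 / 8 * a powr c * a powr - gromov_prod p x y"
        using c(2) by (intro mult_right_mono) auto
      also have "\<dots> = \<eta> * \<tau>0 / 8 * a powr (c - gromov_prod p x y)"
        by (simp add: powr_add[symmetric])
      also have "\<dots> \<le> \<eta> * \<tau>0 / 8 * a powr (- \<omega> * real k)"
        using a \<eta> \<tau>0 k' by (intro mult_left_mono powr_mono) auto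
      also have "\<dots> = \<eta> * \<tau> k / 8"
        unfolding \<tau>_def by simp
      finally show "\<rho> x y \<le> \<eta> * \<tau> k / 8" .
    qed
    have le: "(gromov_prod p x y - c) / \<omega> \<le> dist x p / \<omega>"
      using \<omega> c(1) gromov_prod_le(1)[of p x y] by (intro divide_right_mono) auto
    have "real (card (S i x - S i y)) \<le> dist x p / \<omega> - (gromov_prod p x y - c) / \<omega> + 2"
      unfolding S_def
      by (rule separated_families.card_nest_diff_le[OF fam[OF \<open>i < n\<close>] close \<kappa>_le le])
    then show ?thesis
      by (simp add: add_divide_distrib diff_divide_distrib)
  qed
  have upper: "dT i (F i x) (F i y) \<le> dist x y / \<omega> + (2 * c / \<omega> + 4)" if "i < n" for i x y
    using card_le[OF that, of x y] card_le[OF that, of y x] gromov_prod_commute[of p x y]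
    unfolding tree(3)[OF that] dist_eq[of x y] by (simp add: add_divide_distrib diff_divide_distrib)

  \<comment> \<open>The counterpart of \<open>c\<close>: beyond level
    \<open>(gromov_prod p x y + c') / \<omega>\<close> the envelopes are smaller than
    \<open>B * a powr - gromov_prod p x y\<close>.\<close>
  define c' where "c' = max 0 (log a (2 * \<tau>0 / B))"
  have c': "0 \<le> c'" "2 * \<tau>0 \<le> B * a powr c'"
  proof -
    have "2 * \<tau>0 / B = a powr (log a (2 * \<tau>0 / B))"
      using a AB \<tau>0 by simp
    also have "\<dots> \<le> a powr c'"
      using a unfolding c'_def by (intro powr_mono) auto
    finally show "2 * \<tau>0 \<le> B * a powr c'"
      using AB by (simp add: field_simps)
  qed (simp add: c'_def)
  define tot where "tot x y = (\<Sum>i<n. real (card (S i x - S i y)))" for x y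
  have tot_nonneg: "0 \<le> tot x y" for x y
    unfolding tot_def by (simp add: sum_nonneg)
  \<comment> \<open>Levels beyond \<open>dist y p / \<omega>\<close> exceed
    \<open>\<kappa> y\<close>, whatever the boundary distance is.\<close>
  have radial: "(dist x p - dist y p) / \<omega> - 1 \<le> tot x y" for x y
  proof -
    have "\<kappa> y < k \<or> 2 * \<tau> k < \<rho> x y" if "dist y p / \<omega> < real k" for k
      using that \<kappa>_le[of y] by linarith
    then have "real (\<kappa> x) - dist y p / \<omega> \<le> tot x y"
      unfolding tot_def S_def using \<omega> by (intro sum_card_nest_diff_ge fam cover) auto
    then show ?thesis
      using \<kappa>_ge[of x] by (simp add: diff_divide_distrib)
  qed
  have branching: "(dist x p - gromov_prod p x y - c') / \<omega> - 1 \<le> tot x y"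
    if far: "B * a powr - gromov_prod p x y \<le> \<rho> x y" for x y
  proof -
    have "2 * \<tau> k < \<rho> x y" if k: "(gromov_prod p x y + c') / \<omega> < real k" for k
    proof -
      have k': "gromov_prod p x y + c' < \<omega> * real k"
        using k \<omega> by (simp add: field_simps)
      have "2 * \<tau> k \<le> B * a powr c' * a powr (- \<omega> * real k)"
        unfolding \<tau>_def using c'(2) mult_right_mono[OF c'(2), of "a powr (- \<omega> * real k)"] by simp
      also have "\<dots> = B * a powr (c' - \<omega> * real k)"
        by (simp add: powr_add[symmetric])
      also have "\<dots> < B * a powr - gromov_prod p x y"
        using AB a k' by (intro mult_strict_left_mono powr_less_mono) auto
      finally show ?thesis using far by simp
    qed
    then have "real (\<kappa> x) - (gromov_prod p x y + c') / \<omega> \<le> tot x y"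
      unfolding tot_def S_def using \<omega> c'(1) gromov_prod_nonneg[of p x y]
      by (intro sum_card_nest_diff_ge fam cover) auto
    then show ?thesis
      using \<kappa>_ge[of x] by (simp add: diff_divide_distrib add_divide_distrib)
  qed
  have lower: "dist x y / \<omega> - (2 * (c' + \<bar>D\<bar>) / \<omega> + 2) \<le> (\<Sum>i<n. dT i (F i x) (F i y))" for x y
  proof -
    have sum: "(\<Sum>i<n. dT i (F i x) (F i y)) = tot x y + tot y x"
      unfolding tot_def sum.distrib[symmetric] using tree(3) by (intro sum.cong) auto
    have "tot x y + tot y x \<ge> (dist x y - 2 * (c' + \<bar>D\<bar>)) / \<omega> - 2"
      using dB[of x y]
    proof
      \<comment> \<open>Here one point lies almost on the way from \<open>p\<close> to the other: up
        to \<open>2 * \<bar>D\<bar>\<close>, the distance is the difference of the distances to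
        \<open>p\<close>, and \<open>radial\<close> suffices.\<close>
      assume near: "min (dist x p) (dist y p) - D \<le> gromov_prod p x y"
      have "dist x y - 2 * (c' + \<bar>D\<bar>) \<le> \<bar>dist x p - dist y p\<bar>"
        using near c'(1) dist_eq[of x y] abs_ge_self[of D]
        by (cases "dist x p \<le> dist y p") auto
      then have "(dist x y - 2 * (c' + \<bar>D\<bar>)) / \<omega> \<le> \<bar>dist x p - dist y p\<bar> / \<omega>"
        using \<omega> by (intro divide_right_mono) auto
      also have "\<dots> \<le> tot x y + tot y x + 1"
        using radial[of x y] radial[of y x] tot_nonneg[of x y] tot_nonneg[of y x]
        by (cases "dist x p \<le> dist y p") auto
      finally show ?thesis by simp
    next
      \<comment> \<open>Here \<open>branching\<close> in both directions counts the two legs beyond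
        the branching level, and \<open>dist_eq\<close> adds them up to
        \<open>dist x y\<close>.\<close>
      assume far: "B * a powr - gromov_prod p x y \<le> d (\<xi> x) (\<xi> y)"
      have far': "B * a powr - gromov_prod p y x \<le> d (\<xi> y) (\<xi> x)"
        using far met \<xi> unfolding gromov_prod_commute[of p y x] metric_on_def by simp
      have "(dist x y - 2 * (c' + \<bar>D\<bar>)) / \<omega> \<le> (dist x y - 2 * c') / \<omega>"
        using \<omega> by (intro divide_right_mono) auto
      then show ?thesis
        using branching[of x y] branching[of y x] far far'
        unfolding \<rho>_def dist_eq[of x y] gromov_prod_commute[of p y x]
        by (simp add: diff_divide_distrib add_divide_distrib)
    qed
    then show ?thesis
      unfolding sum by (simp add: diff_divide_distrib)
  qed

  have "qi_embedding dist (prod_dist n dT) (\<lambda>x i. F i x)"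
  proof (rule qi_embedding_prod_distI)
    show "0 < n" unfolding n_def by simp
    show "0 \<le> 2 * c / \<omega> + 4" "0 \<le> 2 * (c' + \<bar>D\<bar>) / \<omega> + 2"
      using c(1) c'(1) \<omega> by auto
  qed (use \<omega> upper lower tree(3) in auto)
  then show ?thesis
    unfolding n_def[symmetric] using tree(1,2)
    by (intro exI[of _ T] exI[of _ dT] exI[of _ "\<lambda>x i. F i x"]) auto
qed

end
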